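(* Let $\phi$ be a photon in $\mathbb{E}\mathrm{in}^{1,2}$ and $G$ a connected Lie subgroup of $\mathrm{Conf}(\mathbb{E}\mathrm{in}^{1,2})$. If $G$ preserves $\phi$ and admits a 2-dimensional orbit in $\mathbb{E}\mathrm{in}^{1,2}$, then it fixes a point in the projective space $\mathbb{RP}^4=\mathbb{P}(\mathbb{R}^{2,3})$. Therefore, $G$ preserves in $\mathbb{E}\mathrm{in}^{1,2}$ a Minkowski patch or a de Sitter component or an anti de Sitter component.
   Context: $\mathbb{R}^{2,3}$ is $\mathbb{R}^5$ with the quadratic form $\mathfrak{q}(v)=-v_1^2-v_2^2+v_3^2+v_4^2+v_5^2$; $\mathbb{E}\mathrm{in}^{1,2}\subset\mathbb{RP}^4$ is the projectivization of the set of nonzero null vectors, with its induced Lorentzian conformal structure, and $\mathrm{Conf}(\mathbb{E}\mathrm{in}^{1,2})=PO(2,3)$, with identity component $SO_\circ(2,3)$. A photon is the projectivization of a totally isotropic 2-plane of $\mathbb{R}^{2,3}$. For a nonzero vector $v\in\mathbb{R}^{2,3}$, the complement $\mathbb{E}\mathrm{in}^{1,2}\setminus\mathbb{P}(v^\perp)$ is called a Minkowski patch if $\mathfrak q(v)=0$, a de Sitter component if $\mathfrak q(v)<0$, and an anti de Sitter component if $\mathfrak q(v)>0$. Lie subgroups are not assumed closed. *)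

theory Defs
  imports "HOL-Analysis.Analysis" "HOL-Algebra.Group"
begin

section \<open>Projectivization\<close>

text \<open>A point of a projective space is a line through the origin, as a set of vectors.
  \<^term>\<open>proj S\<close> is the set of lines spanned by the nonzero vectors of \<open>S\<close>; in particular
  \<open>proj UNIV\<close> is the whole projective space.\<close>

definition proj :: "'a::real_vector set \<Rightarrow> 'a set set" where
  "proj S = {span {v} | v. v \<in> S \<and> v \<noteq> 0}"


section \<open>Immersed submanifolds of a projective space\<close>

text \<open>Local charts have their domain in a subspace \<open>W\<close> of a Euclidean space, of arbitrary
  dimension; it plays the role of \<open>\<real>\<^sup>k\<close>. Here \<open>V\<close> is relatively open in \<open>W\<close>, so a derivative
  within \<open>V\<close> is determined exactly in the directions of \<open>W\<close>.\<close>

fun C_on :: "nat \<Rightarrow> 'a::real_normed_vector set \<Rightarrow> 'a set \<Rightarrow> ('a \<Rightarrow> 'b::real_normed_vector) \<Rightarrow> bool" where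
  "C_on 0 W V f \<longleftrightarrow> continuous_on V f"
| "C_on (Suc n) W V f \<longleftrightarrow>
     (\<exists>f'. (\<forall>x\<in>V. (f has_derivative f' x) (at x within V)) \<and> (\<forall>w\<in>W. C_on n W V (\<lambda>x. f' x w)))"

definition smooth_on :: "'a::real_normed_vector set \<Rightarrow> 'a set \<Rightarrow> ('a \<Rightarrow> 'b::real_normed_vector) \<Rightarrow> bool" where
  "smooth_on W V f \<longleftrightarrow> (\<forall>n. C_on n W V f)"

text \<open>\<open>f\<close> is a lift to \<open>E - {0}\<close> of the map \<open>x \<mapsto> [f x]\<close> into the projective space of \<open>E\<close>. Since the
  kernel of the differential of \<open>E - {0} \<rightarrow> proj E\<close> at \<open>f x\<close> is the line of \<open>f x\<close>, the map \<open>x \<mapsto> [f x]\<close>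
  is an immersion iff no nonzero direction is sent into that line by the derivative of \<open>f\<close>.\<close>

definition proj_immersion :: "'a::euclidean_space set \<Rightarrow> 'a set \<Rightarrow> ('a \<Rightarrow> 'a) \<Rightarrow> bool" where
  "proj_immersion W V f \<longleftrightarrow>
     smooth_on W V f \<and>
     (\<forall>x\<in>V. f x \<noteq> 0 \<and>
        (\<exists>f'. (f has_derivative f') (at x within V) \<and> (\<forall>w\<in>W. f' w \<in> span {f x} \<longrightarrow> w = 0)))"

text \<open>Inverse charts of dimension \<open>k\<close> of a set of projective points with the topology \<open>T\<close>, which may
  be finer than the subspace topology.\<close>

definition charts :: "nat \<Rightarrow> 'a::euclidean_space set topology \<Rightarrow> ('a set \<times> 'a set \<times> ('a \<Rightarrow> 'a)) set" where
  "charts k T = {(W, V, f).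
     subspace W \<and> dim W = k \<and> openin (top_of_set W) V \<and> proj_immersion W V f \<and>
     openin T ((\<lambda>x. span {f x}) ` V) \<and>
     homeomorphic_map (top_of_set V) (subtopology T ((\<lambda>x. span {f x}) ` V)) (\<lambda>x. span {f x})}"

definition second_countable :: "'a topology \<Rightarrow> bool" where
  "second_countable T \<longleftrightarrow>
     (\<exists>\<B>. countable \<B> \<and> (\<forall>B\<in>\<B>. openin T B) \<and>
          (\<forall>U x. openin T U \<and> x \<in> U \<longrightarrow> (\<exists>B\<in>\<B>. x \<in> B \<and> B \<subseteq> U)))"

text \<open>Any two of these charts are smoothly compatible: the change of charts is continuous by the
  choice of \<open>T\<close>, and each chart is locally an embedding into projective space. So \<open>T\<close> determines the
  smooth structure, for which the inclusion into projective space is an injective immersion.\<close>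

definition immersed_manifold :: "nat \<Rightarrow> 'a::euclidean_space set topology \<Rightarrow> bool" where
  "immersed_manifold k T \<longleftrightarrow>
     Hausdorff_space T \<and> second_countable T \<and>
     (\<forall>p\<in>topspace T. \<exists>(W, V, f)\<in>charts k T. p \<in> (\<lambda>x. span {f x}) ` V)"

text \<open>The orbit of a Lie group is an immersed submanifold. By second countability, its dimension depends only on
  the underlying set.\<close>

definition immersed_submanifold :: "nat \<Rightarrow> 'a::euclidean_space set set \<Rightarrow> bool" where
  "immersed_submanifold k S \<longleftrightarrow> (\<exists>T. topspace T = S \<and> immersed_manifold k T)"


section \<open>Lie subgroups of projective groups\<close>

text \<open>\<open>H\<close> is a group whose elements are points of a projective space (of matrices). A Lie subgroup is a
  subgroup with a manifold structure for which the group operations are smooth and the inclusion is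
  an immersion; its topology \<open>T\<close> need not be the subspace topology, so it need not be closed.
  Connectedness refers to \<open>T\<close>.\<close>

definition smooth_mult :: "('a::euclidean_space set, 'b) monoid_scheme \<Rightarrow> nat \<Rightarrow> 'a set topology \<Rightarrow> bool" where
  "smooth_mult H k T \<longleftrightarrow>
     (\<forall>g\<in>topspace T. \<forall>h\<in>topspace T.
        \<exists>(W1, V1, f1)\<in>charts k T. \<exists>(W2, V2, f2)\<in>charts k T. \<exists>(W3, V3, f3)\<in>charts k T. \<exists>F.
          g \<in> (\<lambda>x. span {f1 x}) ` V1 \<and> h \<in> (\<lambda>x. span {f2 x}) ` V2 \<and>
          smooth_on (W1 \<times> W2) (V1 \<times> V2) F \<and>
          (\<forall>x\<in>V1. \<forall>y\<in>V2. F (x, y) \<in> V3 \<and>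
             span {f3 (F (x, y))} = span {f1 x} \<otimes>\<^bsub>H\<^esub> span {f2 y}))"

definition smooth_inv :: "('a::euclidean_space set, 'b) monoid_scheme \<Rightarrow> nat \<Rightarrow> 'a set topology \<Rightarrow> bool" where
  "smooth_inv H k T \<longleftrightarrow>
     (\<forall>g\<in>topspace T.
        \<exists>(W1, V1, f1)\<in>charts k T. \<exists>(W2, V2, f2)\<in>charts k T. \<exists>F.
          g \<in> (\<lambda>x. span {f1 x}) ` V1 \<and>
          smooth_on W1 V1 F \<and>
          (\<forall>x\<in>V1. F x \<in> V2 \<and> span {f2 (F x)} = inv\<^bsub>H\<^esub> (span {f1 x})))"

definition connected_lie_subgroup :: "'a::euclidean_space set set \<Rightarrow> ('a set, 'b) monoid_scheme \<Rightarrow> bool" where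
  "connected_lie_subgroup G H \<longleftrightarrow>
     subgroup G H \<and>
     (\<exists>k T. topspace T = G \<and> immersed_manifold k T \<and> connected_space T \<and>
            smooth_mult H k T \<and> smooth_inv H k T)"


section \<open>The Einstein universe\<close>

definition bil :: "real^5 \<Rightarrow> real^5 \<Rightarrow> real" where
  "bil u v = - (u$1 * v$1) - u$2 * v$2 + u$3 * v$3 + u$4 * v$4 + u$5 * v$5"

definition qf :: "real^5 \<Rightarrow> real" where
  "qf v = - (v$1)\<^sup>2 - (v$2)\<^sup>2 + (v$3)\<^sup>2 + (v$4)\<^sup>2 + (v$5)\<^sup>2"

lemma qf_eq_bil: "qf v = bil v v"
  by (simp add: qf_def bil_def power2_eq_square)

definition RP4 :: "(real^5) set set" where
  "RP4 = proj UNIV"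

definition Ein :: "(real^5) set set" where
  "Ein = proj {v. qf v = 0}"

definition photon :: "(real^5) set set \<Rightarrow> bool" where
  "photon \<phi> \<longleftrightarrow> (\<exists>P. subspace P \<and> dim P = 2 \<and> (\<forall>u\<in>P. \<forall>v\<in>P. bil u v = 0) \<and> \<phi> = proj P)"

definition perp :: "real^5 \<Rightarrow> (real^5) set" where
  "perp v = {x. bil v x = 0}"

definition minkowski_patch :: "(real^5) set set \<Rightarrow> bool" where
  "minkowski_patch U \<longleftrightarrow> (\<exists>v. v \<noteq> 0 \<and> qf v = 0 \<and> U = Ein - proj (perp v))"

definition de_sitter_component :: "(real^5) set set \<Rightarrow> bool" where
  "de_sitter_component U \<longleftrightarrow> (\<exists>v. v \<noteq> 0 \<and> qf v < 0 \<and> U = Ein - proj (perp v))"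

definition anti_de_sitter_component :: "(real^5) set set \<Rightarrow> bool" where
  "anti_de_sitter_component U \<longleftrightarrow> (\<exists>v. v \<noteq> 0 \<and> qf v > 0 \<and> U = Ein - proj (perp v))"


section \<open>The conformal group\<close>

definition O23 :: "(real^5^5) set" where
  "O23 = {A. \<forall>v. qf (A *v v) = qf v}"

text \<open>An element of \<open>PO(2,3)\<close> is the line of all multiples of an isometry, i.e. a point of the
  projective space of matrices, of which \<open>PGL(5)\<close> is an open subset. The elementwise product of two
  such lines is again a line.\<close>

definition Conf_Ein :: "(real^5^5) set monoid" where
  "Conf_Ein = \<lparr> carrier = proj O23,
               monoid.mult = (\<lambda>g h. {A ** B | A B. A \<in> g \<and> B \<in> h}),
               one = span {mat 1} \<rparr>"

definition act :: "(real^5^5) set \<Rightarrow> (real^5) set \<Rightarrow> (real^5) set" where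
  "act g p = {A *v x | A x. A \<in> g \<and> x \<in> p}"

definition orbit :: "(real^5^5) set set \<Rightarrow> (real^5) set \<Rightarrow> (real^5) set set" where
  "orbit G p = (\<lambda>g. act g p) ` G"

definition preserves :: "(real^5^5) set set \<Rightarrow> (real^5) set set \<Rightarrow> bool" where
  "preserves G S \<longleftrightarrow> (\<forall>g\<in>G. act g ` S = S)"

end

theory Submission
  imports Defs
begin

text \<open>
  Let \<open>P\<close> be the totally isotropic plane of the photon. Then \<open>P\<^sup>\<perp> / P\<close> is a definite line, and an
  infinitesimal isometry that preserves \<open>P\<close> acts on \<open>P\<^sup>\<perp>\<close> as an infinitesimal affine transformation of
  a plane \<open>e0 + P\<close>; those that act on it by translations form a Heisenberg algebra. Let \<open>\<gg>\<close> be the Lie algebra of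
  the group.

  If \<open>\<gg>\<close> has an eigenvector in \<open>P\<close>, or if its affine action on \<open>e0 + P\<close> has a fixed point, then \<open>\<gg>\<close> preserves
  a line of \<open>\<real>\<^sup>5\<close>, and so does the group, which is connected (\<open>invariant_line\<close>). Otherwise the linear parts
  form an irreducible subalgebra of \<open>gl(2)\<close>, which is commutative or contains \<open>sl(2)\<close>. If \<open>\<gg>\<close> contained no
  nonzero translation of \<open>e0 + P\<close>, the affine action would have a fixed point: the first cohomology of
  such a subalgebra with coefficients in the plane vanishes. So \<open>\<gg>\<close> contains a translation, then by irreducibility all of them and, with their
  brackets, the whole Heisenberg algebra (\<open>common_fixed_point_or_heisenberg\<close>).

  In this last case the orbits off the photon are open in the Einstein universe, which has dimension \<open>3\<close>
  (\<open>orbit_directions_with_transversal\<close> and \<open>orbit_not_negligible\<close>), while the orbits on the photon are contained in a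
  one-dimensional set. Neither can be an immersed surface: by second countability the cone over a
  surface is covered by countably many small pieces (\<open>negligible_cone_over_surface\<close>), and a surface cannot
  be immersed in a projective line (\<open>no_surface_in_projective_line\<close>). Hence a two-dimensional orbit
  forces an invariant line, spanned by \<open>v\<close> say, and the complement of the hyperplane orthogonal to \<open>v\<close> is the
  invariant Minkowski patch, de Sitter component or anti de Sitter component, according to the sign of \<open>qf v\<close>.

  The Lie algebra is taken as the set of velocities at the identity of curves in the group. Conjugating
  and multiplying curves gives its algebraic properties directly, without exponentials, and curves
  are all that the open mapping argument needs.
\<close>


section \<open>Matrix groups and the velocities of their curves\<close>

lemma bounded_bilinear_matrix_vector_mult:
  "bounded_bilinear ((*v) :: real^'n^'m \<Rightarrow> real^'n \<Rightarrow> real^'m)"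
  unfolding bilinear_conv_bounded_bilinear[symmetric] bilinear_def
  by (auto intro!: linearI simp: algebra_simps scaleR_matrix_vector_assoc)

lemma bounded_bilinear_matrix_mult:
  "bounded_bilinear ((**) :: real^'n^'m \<Rightarrow> real^'k^'n \<Rightarrow> real^'k^'m)"
  unfolding bilinear_conv_bounded_bilinear[symmetric] bilinear_def
  by (intro conjI allI linearI)
    (simp_all add: matrix_matrix_mult_def vec_eq_iff sum.distrib sum_distrib_left
      distrib_left distrib_right ac_simps)

lemmas matrix_mult_diff_left = bounded_bilinear.diff_left[OF bounded_bilinear_matrix_mult]
lemmas matrix_mult_diff_right = bounded_bilinear.diff_right[OF bounded_bilinear_matrix_mult]
lemmas matrix_mult_scaleR_left = bounded_bilinear.scaleR_left[OF bounded_bilinear_matrix_mult]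
lemmas matrix_mult_scaleR_right = bounded_bilinear.scaleR_right[OF bounded_bilinear_matrix_mult]
lemmas matrix_vector_scaleR_left = bounded_bilinear.scaleR_left[OF bounded_bilinear_matrix_vector_mult]
lemmas matrix_vector_scaleR_right = bounded_bilinear.scaleR_right[OF bounded_bilinear_matrix_vector_mult]

text \<open>A subspace is the common kernel of the functionals \<open>y \<bullet> _\<close> with \<open>y\<close> in its orthogonal complement, and each of
  these is constant along the curve.\<close>

lemma vector_derivative_in_subspace:
  fixes \<gamma> :: "real \<Rightarrow> 'a::euclidean_space"
  assumes "subspace S" and "(\<gamma> has_vector_derivative X) (at t)"
    and "0 < e" and "\<And>s. \<bar>s - t\<bar> < e \<Longrightarrow> \<gamma> s \<in> S"
  shows "X \<in> S"
proof -
  have "y \<bullet> X = 0" if "y \<in> orthogonal_comp S" for y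
  proof -
    have "((\<lambda>s. y \<bullet> \<gamma> s) has_vector_derivative y \<bullet> X) (at t)"
      using assms(2) by (rule bounded_linear.has_vector_derivative[OF bounded_linear_inner_right])
    then have "((\<lambda>s. 0) has_vector_derivative y \<bullet> X) (at t)"
    proof (rule has_vector_derivative_transform_within_open[where S = "ball t e"])
      show "y \<bullet> \<gamma> s = 0" if "s \<in> ball t e" for s
      proof -
        have "\<gamma> s \<in> S"
          using that assms(4)[of s] by (simp add: dist_real_def abs_minus_commute)
        then show ?thesis
          using \<open>y \<in> orthogonal_comp S\<close>
          by (auto simp: orthogonal_comp_def orthogonal_def inner_commute)
      qed
    qed (use assms(3) in auto)
    then show ?thesis
      using vector_derivative_unique_at has_vector_derivative_const by blast
  qed
  then have "X \<in> orthogonal_comp (orthogonal_comp S)"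
    by (auto simp: orthogonal_comp_def orthogonal_def)
  then show ?thesis
    using orthogonal_comp_self[OF assms(1)] by simp
qed

lemma vector_derivative_quotient_at_0:
  assumes "(f has_vector_derivative D) (at (0::real))" "f 0 = 0"
  shows "((\<lambda>t. (1 / t) *\<^sub>R f t) \<longlongrightarrow> D) (at 0)"
proof -
  have "((\<lambda>h. norm (f h - h *\<^sub>R D) / norm h) \<longlongrightarrow> 0) (at 0)"
    using assms unfolding has_vector_derivative_def has_derivative_at by simp
  moreover have "\<forall>\<^sub>F h in at 0. norm (f h - h *\<^sub>R D) / norm h = norm ((1 / h) *\<^sub>R f h - D)"
  proof (rule eventually_at_filter[THEN iffD2], rule always_eventually, intro allI impI)
    fix h :: real assume "h \<noteq> 0"
    then have "(1 / h) *\<^sub>R f h - D = (1 / h) *\<^sub>R (f h - h *\<^sub>R D)"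
      by (simp add: algebra_simps)
    then show "norm (f h - h *\<^sub>R D) / norm h = norm ((1 / h) *\<^sub>R f h - D)"
      by (simp add: divide_inverse)
  qed
  ultimately have "((\<lambda>h. norm ((1 / h) *\<^sub>R f h - D)) \<longlongrightarrow> 0) (at 0)"
    by (rule Lim_transform_eventually)
  then show ?thesis
    by (rule LIM_zero_cancel[OF tendsto_norm_zero_cancel])
qed

text \<open>Closure under nonzero scalars makes \<open>\<Gamma>\<close> the full preimage of a group of projective transformations,
  so that no representative of a projective matrix ever has to be normalized.\<close>

locale linear_group =
  fixes \<Gamma> :: "(real^'n^'n) set"
  assumes one: "mat 1 \<in> \<Gamma>"
    and mult: "A \<in> \<Gamma> \<Longrightarrow> B \<in> \<Gamma> \<Longrightarrow> A ** B \<in> \<Gamma>"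
    and inverse: "A \<in> \<Gamma> \<Longrightarrow> \<exists>B\<in>\<Gamma>. A ** B = mat 1 \<and> B ** A = mat 1"
    and scale: "A \<in> \<Gamma> \<Longrightarrow> c \<noteq> 0 \<Longrightarrow> c *\<^sub>R A \<in> \<Gamma>"
begin

text \<open>The Lie algebra, described by velocities of curves instead of charts. The curve is required to be
  continuous everywhere but differentiable only at \<open>0\<close>: this is weak enough that products, conjugates
  and reparametrizations of such curves are again such curves, and strong enough for the open mapping
  theorem used in \<open>orbit_not_negligible\<close>.\<close>

definition tangent :: "(real^'n^'n) set" where
  "tangent = {X. \<exists>\<gamma>. continuous_on UNIV \<gamma> \<and> range \<gamma> \<subseteq> \<Gamma> \<and> \<gamma> (0::real) = mat 1 \<and>
                     (\<gamma> has_vector_derivative X) (at 0)}"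

lemma tangentE:
  assumes "X \<in> tangent"
  obtains \<gamma> :: "real \<Rightarrow> real^'n^'n" where "continuous_on UNIV \<gamma>" "\<And>t. \<gamma> t \<in> \<Gamma>" "\<gamma> 0 = mat 1"
    "(\<gamma> has_vector_derivative X) (at 0)"
  using assms unfolding tangent_def by blast

text \<open>Composing with the retraction of the line onto \<open>{-e..e}\<close> extends the curve without changing it near \<open>0\<close>.\<close>

lemma tangent_of_local_curve:
  assumes "0 < e" "continuous_on {-e..e} \<gamma>" "\<And>t. t \<in> {-e..e} \<Longrightarrow> \<gamma> t \<in> \<Gamma>" "\<gamma> (0::real) = mat 1"
    "(\<gamma> has_vector_derivative X) (at 0)"
  shows "X \<in> tangent"
proof -
  define c where "c t = max (- e) (min e t)" for t :: real
  have c: "c t \<in> {-e..e}" for t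
    using assms(1) by (auto simp: c_def)
  have "continuous_on UNIV (\<gamma> \<circ> c)"
  proof (rule continuous_on_compose)
    show "continuous_on UNIV c"
      unfolding c_def by (intro continuous_intros)
    show "continuous_on (range c) \<gamma>"
      using assms(2) by (rule continuous_on_subset) (use c in auto)
  qed
  moreover have "((\<gamma> \<circ> c) has_vector_derivative X) (at 0)"
    using assms(5)
    by (rule has_vector_derivative_transform_within_open[where S = "{-e<..<e}"])
      (use assms(1) in \<open>auto simp: c_def\<close>)
  moreover have "(\<gamma> \<circ> c) 0 = mat 1" "range (\<gamma> \<circ> c) \<subseteq> \<Gamma>"
    using assms c by (auto simp: c_def)
  ultimately show ?thesis
    unfolding tangent_def by blast
qed

lemma one_in_tangent: "mat 1 \<in> tangent"
  unfolding tangent_def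
proof (intro CollectI exI conjI)
  let ?\<gamma> = "\<lambda>t::real. exp t *\<^sub>R (mat 1 :: real^'n^'n)"
  show "continuous_on UNIV ?\<gamma>"
    by (intro continuous_intros)
  show "range ?\<gamma> \<subseteq> \<Gamma>"
    using scale[OF one] by auto
  show "(?\<gamma> has_vector_derivative mat 1) (at 0)"
    by (auto intro!: derivative_eq_intros)
qed simp

lemma subspace_tangent: "subspace tangent"
proof (rule subspaceI)
  show "0 \<in> tangent"
    unfolding tangent_def using one
    by (auto intro!: exI[of _ "\<lambda>t. mat 1"])
next
  fix X Y assume "X \<in> tangent" "Y \<in> tangent"
  then obtain \<gamma> \<delta> :: "real \<Rightarrow> real^'n^'n"
    where \<gamma>: "continuous_on UNIV \<gamma>" "\<And>t. \<gamma> t \<in> \<Gamma>" "\<gamma> 0 = mat 1" "(\<gamma> has_vector_derivative X) (at 0)"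
      and \<delta>: "continuous_on UNIV \<delta>" "\<And>t. \<delta> t \<in> \<Gamma>" "\<delta> 0 = mat 1" "(\<delta> has_vector_derivative Y) (at 0)"
    by (metis tangentE)
  have "continuous_on UNIV (\<lambda>t. \<gamma> t ** \<delta> t)"
    using bounded_bilinear.continuous_on[OF bounded_bilinear_matrix_mult] \<gamma>(1) \<delta>(1) by blast
  moreover have "((\<lambda>t. \<gamma> t ** \<delta> t) has_vector_derivative (\<gamma> 0 ** Y + X ** \<delta> 0)) (at 0)"
    using bounded_bilinear.has_vector_derivative[OF bounded_bilinear_matrix_mult \<gamma>(4) \<delta>(4)] .
  ultimately show "X + Y \<in> tangent"
    unfolding tangent_def using \<gamma> \<delta> mult
    by (auto intro!: exI[of _ "\<lambda>t. \<gamma> t ** \<delta> t"] simp: add.commute)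
next
  fix c :: real and X assume "X \<in> tangent"
  then obtain \<gamma> :: "real \<Rightarrow> real^'n^'n"
    where \<gamma>: "continuous_on UNIV \<gamma>" "\<And>t. \<gamma> t \<in> \<Gamma>" "\<gamma> 0 = mat 1" "(\<gamma> has_vector_derivative X) (at 0)"
    by (metis tangentE)
  have "((\<lambda>t. c * t) has_vector_derivative c) (at 0)"
    by (auto intro!: derivative_eq_intros)
  then have "(\<gamma> \<circ> (\<lambda>t. c * t) has_vector_derivative (c *\<^sub>R X)) (at 0)"
    using vector_diff_chain_at \<gamma>(4) by fastforce
  moreover have "continuous_on UNIV (\<gamma> \<circ> (\<lambda>t. c * t))"
    using \<gamma>(1) by (intro continuous_on_compose continuous_intros) (auto intro: continuous_on_subset)
  ultimately show "c *\<^sub>R X \<in> tangent"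
    unfolding tangent_def using \<gamma> by (auto intro!: exI[of _ "\<gamma> \<circ> (\<lambda>t. c * t)"])
qed

lemma tangent_conj:
  assumes "X \<in> tangent" "A \<in> \<Gamma>" "B \<in> \<Gamma>" "A ** B = mat 1"
  shows "A ** X ** B \<in> tangent"
proof -
  obtain \<gamma> :: "real \<Rightarrow> real^'n^'n"
    where \<gamma>: "continuous_on UNIV \<gamma>" "\<And>t. \<gamma> t \<in> \<Gamma>" "\<gamma> 0 = mat 1" "(\<gamma> has_vector_derivative X) (at 0)"
    using assms(1) by (metis tangentE)
  note lin = bounded_linear_compose[OF bounded_bilinear.bounded_linear_left[OF bounded_bilinear_matrix_mult]
       bounded_bilinear.bounded_linear_right[OF bounded_bilinear_matrix_mult]]
  have "continuous_on UNIV (\<lambda>t. A ** \<gamma> t ** B)"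
    using bounded_linear.continuous_on[OF lin \<gamma>(1)] .
  moreover have "((\<lambda>t. A ** \<gamma> t ** B) has_vector_derivative A ** X ** B) (at 0)"
    using bounded_linear.has_vector_derivative[OF lin \<gamma>(4)] .
  ultimately show ?thesis
    unfolding tangent_def using \<gamma> assms mult by (auto intro!: exI[of _ "\<lambda>t. A ** \<gamma> t ** B"])
qed

text \<open>The bracket is the derivative at \<open>0\<close> of \<open>t \<mapsto> \<gamma>(t) Y \<gamma>(t)\<inverse>\<close>, a curve in the subspace \<open>tangent\<close>, which is closed
  because it has finite dimension.\<close>

lemma tangent_bracket:
  assumes "X \<in> tangent" "Y \<in> tangent"
  shows "X ** Y - Y ** X \<in> tangent"
proof -
  obtain \<gamma> :: "real \<Rightarrow> real^'n^'n"
    where \<gamma>: "continuous_on UNIV \<gamma>" "\<And>t. \<gamma> t \<in> \<Gamma>" "\<gamma> 0 = mat 1" "(\<gamma> has_vector_derivative X) (at 0)"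
    using assms(1) by (metis tangentE)
  have "\<forall>t. \<exists>B. B \<in> \<Gamma> \<and> \<gamma> t ** B = mat 1 \<and> B ** \<gamma> t = mat 1"
    using inverse \<gamma>(2) by blast
  then obtain \<delta> where \<delta>: "\<And>t. \<delta> t \<in> \<Gamma>" "\<And>t. \<gamma> t ** \<delta> t = mat 1" "\<And>t. \<delta> t ** \<gamma> t = mat 1"
    by metis
  define R where "R t = (1 / t) *\<^sub>R (\<gamma> t ** Y ** \<delta> t - Y)" for t
  define D where "D t = (1 / t) *\<^sub>R (\<gamma> t ** Y - Y ** \<gamma> t)" for t
  have R: "R t \<in> tangent" for t
    unfolding R_def using tangent_conj[OF assms(2) \<gamma>(2) \<delta>(1) \<delta>(2)] assms(2)
    by (intro subspace_scale subspace_diff subspace_tangent)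
  have RD: "R t ** \<gamma> t = D t" for t
    using \<delta>(3) unfolding R_def D_def
    by (simp add: matrix_mult_scaleR_left matrix_mult_diff_left matrix_mul_assoc[symmetric])
  have "((\<lambda>t. \<gamma> t ** Y - Y ** \<gamma> t) has_vector_derivative (X ** Y - Y ** X)) (at 0)"
    by (intro has_vector_derivative_diff \<gamma>(4)
        bounded_linear.has_vector_derivative[OF bounded_bilinear.bounded_linear_left[OF bounded_bilinear_matrix_mult]]
        bounded_linear.has_vector_derivative[OF bounded_bilinear.bounded_linear_right[OF bounded_bilinear_matrix_mult]])
  then have lim_D: "(D \<longlongrightarrow> X ** Y - Y ** X) (at 0)"
    unfolding D_def by (rule vector_derivative_quotient_at_0) (simp add: \<gamma>(3))
  have "\<exists>K>0. \<forall>(A::real^'n^'n) (B::real^'n^'n). norm (A ** B) \<le> norm A * norm B * K"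
    by (rule bounded_bilinear.pos_bounded[OF bounded_bilinear_matrix_mult])
  then obtain K where K: "0 < K" "\<And>(A::real^'n^'n) (B::real^'n^'n). norm (A ** B) \<le> norm A * norm B * K"
    by auto
  have lim_\<gamma>: "((\<lambda>t. norm (\<gamma> t - mat 1) * K) \<longlongrightarrow> 0) (at 0)"
  proof -
    have "(\<gamma> \<longlongrightarrow> mat 1) (at 0)"
      using \<gamma>(1,3) by (metis UNIV_I continuous_on_def)
    then have "((\<lambda>t. norm (\<gamma> t - mat 1) * K) \<longlongrightarrow> norm (mat 1 - mat 1 :: real^'n^'n) * K) (at 0)"
      by (intro tendsto_intros)
    then show ?thesis by simp
  qed
  \<comment> \<open>\<open>R\<close> need not be known to converge beforehand: \<open>D - R = R (\<gamma> - 1)\<close> first bounds \<open>R\<close>, then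
    shows that \<open>R\<close> and \<open>D\<close> have the same limit.\<close>
  have "\<forall>\<^sub>F t in at 0. norm (\<gamma> t - mat 1) * K < 1/2"
    using lim_\<gamma> by (rule order_tendstoD) simp
  then have bound: "\<forall>\<^sub>F t in at 0. norm (D t - R t) \<le> 2 * norm (D t) * (norm (\<gamma> t - mat 1) * K)"
  proof eventually_elim
    case (elim t)
    have DR: "D t - R t = R t ** (\<gamma> t - mat 1)"
      by (simp add: matrix_mult_diff_right RD)
    have le: "norm (D t - R t) \<le> norm (R t) * (norm (\<gamma> t - mat 1) * K)"
      using K(2)[of "R t" "\<gamma> t - mat 1"] DR by (simp add: mult.assoc)
    also have "\<dots> \<le> norm (R t) * (1/2)"
      using elim by (intro mult_left_mono) auto
    finally have "norm (R t) \<le> 2 * norm (D t)"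
      using norm_triangle_ineq4[of "D t" "D t - R t"] by simp
    then have "norm (R t) * (norm (\<gamma> t - mat 1) * K) \<le> 2 * norm (D t) * (norm (\<gamma> t - mat 1) * K)"
      using K(1) by (intro mult_right_mono) auto
    with le show ?case by linarith
  qed
  have "((\<lambda>t. 2 * norm (D t) * (norm (\<gamma> t - mat 1) * K)) \<longlongrightarrow> 2 * norm (X ** Y - Y ** X) * 0) (at 0)"
    by (rule tendsto_mult[OF tendsto_mult[OF tendsto_const tendsto_norm[OF lim_D]] lim_\<gamma>])
  then have "((\<lambda>t. 2 * norm (D t) * (norm (\<gamma> t - mat 1) * K)) \<longlongrightarrow> 0) (at 0)"
    by simp
  with bound have "((\<lambda>t. D t - R t) \<longlongrightarrow> 0) (at 0)"
    by (rule Lim_null_comparison)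
  then have "((\<lambda>t. D t - (D t - R t)) \<longlongrightarrow> (X ** Y - Y ** X) - 0) (at 0)"
    by (intro tendsto_diff lim_D)
  then have "(R \<longlongrightarrow> X ** Y - Y ** X) (at 0)"
    by simp
  then show ?thesis
    by (rule Lim_in_closed_set[OF closed_subspace[OF subspace_tangent], rotated 2]) (auto simp: R)
qed

lemma tangent_apply_subspace:
  assumes "X \<in> tangent" "subspace S" "\<And>A. A \<in> \<Gamma> \<Longrightarrow> A *v v \<in> S"
  shows "X *v v \<in> S"
proof -
  obtain \<gamma> :: "real \<Rightarrow> real^'n^'n"
    where \<gamma>: "continuous_on UNIV \<gamma>" "\<And>t. \<gamma> t \<in> \<Gamma>" "\<gamma> 0 = mat 1" "(\<gamma> has_vector_derivative X) (at 0)"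
    using assms(1) by (metis tangentE)
  show ?thesis
    using bounded_linear.has_vector_derivative[OF bounded_bilinear.bounded_linear_left[OF bounded_bilinear_matrix_vector_mult] \<gamma>(4)]
    by (rule vector_derivative_in_subspace[OF assms(2), where e = 1]) (use assms(3) \<gamma>(2) in auto)
qed

end


section \<open>Subalgebras of the stabilizer of an isotropic plane\<close>

text \<open>Let \<open>P\<close> be a totally isotropic plane. An infinitesimal isometry that preserves \<open>P\<close> is determined by
  its restriction to \<open>P\<close>, the \<open>2 \<times> 2\<close> matrix \<open>A\<close> with rows \<open>(a, b)\<close> and \<open>(c, d)\<close>, by the translation part
  \<open>(t, u)\<close> of its action on \<open>P\<^sup>\<perp>\<close>, whose quotient by \<open>P\<close> is a line, and by one more number \<open>s\<close>. The tuples with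
  \<open>A = 0\<close> form a Heisenberg algebra with centre the \<open>s\<close>-axis.\<close>

type_synonym parabolic = "real \<times> real \<times> real \<times> real \<times> real \<times> real \<times> real"

fun parabolic_bracket :: "parabolic \<Rightarrow> parabolic \<Rightarrow> parabolic" where
  "parabolic_bracket (a, b, c, d, t, u, s) (a', b', c', d', t', u', s') =
    (b * c' - b' * c, a * b' + b * d' - a' * b - b' * d, c * a' + d * c' - c' * a - d' * c, c * b' - c' * b,
     a * t' + b * u' - a' * t - b' * u, c * t' + d * u' - c' * t - d' * u,
     (a + d) * s' - (a' + d') * s + t * u' - u * t')"

text \<open>The vector \<open>(x, y)\<close> is an eigenvector of \<open>A\<close> iff the determinant of \<open>(x, y)\<close> and \<open>A (x, y)\<close> vanishes;
  so the last assumption says that the matrices \<open>A\<close> have no common eigenvector.\<close>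

locale parabolic_subalgebra =
  fixes \<ss> :: "parabolic set"
  assumes subspace: "subspace \<ss>"
    and bracket_closed: "\<And>p q. p \<in> \<ss> \<Longrightarrow> q \<in> \<ss> \<Longrightarrow> parabolic_bracket p q \<in> \<ss>"
    and irreducible: "\<And>x y. x \<noteq> 0 \<or> y \<noteq> 0 \<Longrightarrow>
      \<exists>a b c d t u s. (a, b, c, d, t, u, s) \<in> \<ss> \<and> x * (c * x + d * y) - y * (a * x + b * y) \<noteq> 0"
begin

lemma combination: "p \<in> \<ss> \<Longrightarrow> q \<in> \<ss> \<Longrightarrow> \<alpha> *\<^sub>R p + \<beta> *\<^sub>R q \<in> \<ss>"
  using subspace by (intro subspace_add subspace_scale)

text \<open>The set of translation parts of elements with \<open>A = 0\<close> is invariant under all the \<open>A\<close>, so by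
  irreducibility one nonzero translation gives the whole plane of them. The bracket of two independent
  ones then spans the centre.\<close>

lemma heisenberg_subset:
  assumes X: "(0, 0, 0, 0, t, u, s) \<in> \<ss>" and "t \<noteq> 0 \<or> u \<noteq> 0"
  shows "(0, 0, 0, 0, t', u', s') \<in> \<ss>"
proof -
  obtain a b c d t1 u1 s1 where Y: "(a, b, c, d, t1, u1, s1) \<in> \<ss>"
    and moves: "t * (c * t + d * u) - u * (a * t + b * u) \<noteq> 0"
    using irreducible[OF assms(2)] by blast
  define v where "v = a * t + b * u"
  define w where "w = c * t + d * u"
  define r where "r = (a + d) * s + t1 * u - u1 * t"
  define D where "D = t * w - u * v"
  have D: "D \<noteq> 0"
    using moves by (simp add: D_def v_def w_def)
  have Z: "(0, 0, 0, 0, v, w, r) \<in> \<ss>"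
    using bracket_closed[OF Y X] by (simp add: v_def w_def r_def)
  have "(0, 0, 0, 0, 0, 0, D) \<in> \<ss>"
    using bracket_closed[OF X Z] by (simp add: D_def)
  note centre = this
  define p where "p = (t' * w - u' * v) / D"
  define q where "q = (t * u' - u * t') / D"
  have pq: "p * t + q * v = t'" "p * u + q * w = u'"
  proof -
    have "p * D = t' * w - u' * v" "q * D = t * u' - u * t'"
      using D by (simp_all add: p_def q_def)
    then have "D * (p * t + q * v) = D * t'" "D * (p * u + q * w) = D * u'"
      using D_def by algebra+
    then show "p * t + q * v = t'" "p * u + q * w = u'"
      using D by simp_all
  qed
  show ?thesis
    using combination[OF combination[OF X Z, of p q] centre, of 1 "(s' - p * s - q * r) / D"] D pq
    by simp
qed

text \<open>A nonzero \<open>A\<close> is invertible, since its kernel is invariant under the matrices that commute with it.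
  So a single element of the affine action has exactly one fixed point, and the others, which commute
  with it, fix this point too.\<close>

lemma common_fixed_point_commuting:
  assumes translation_free: "\<And>t u s. (0, 0, 0, 0, t, u, s) \<in> \<ss> \<Longrightarrow> t = 0 \<and> u = 0"
    and commuting: "\<And>p q. p \<in> \<ss> \<Longrightarrow> q \<in> \<ss> \<Longrightarrow> \<exists>t u s. parabolic_bracket p q = (0, 0, 0, 0, t, u, s)"
  shows "\<exists>x y. \<forall>a b c d t u s. (a, b, c, d, t, u, s) \<in> \<ss> \<longrightarrow> a * x + b * y + t = 0 \<and> c * x + d * y + u = 0"
proof -
  obtain a b c d t u s where X: "(a, b, c, d, t, u, s) \<in> \<ss>" and c: "c \<noteq> 0"
    using irreducible[of 1 0] by auto
  have comm: "b * c' = b' * c" "a * b' + b * d' = a' * b + b' * d" "c * a' + d * c' = c' * a + d' * c"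
      "a * t' + b * u' = a' * t + b' * u" "c * t' + d * u' = c' * t + d' * u"
    if Y: "(a', b', c', d', t', u', s') \<in> \<ss>" for a' b' c' d' t' u' s'
  proof -
    obtain t2 u2 s2 where eq: "parabolic_bracket (a, b, c, d, t, u, s) (a', b', c', d', t', u', s') = (0, 0, 0, 0, t2, u2, s2)"
      using commuting[OF X Y] by blast
    then have "t2 = 0 \<and> u2 = 0"
      using bracket_closed[OF X Y] translation_free by metis
    with eq show "b * c' = b' * c" "a * b' + b * d' = a' * b + b' * d" "c * a' + d * c' = c' * a + d' * c"
      "a * t' + b * u' = a' * t + b' * u" "c * t' + d * u' = c' * t + d' * u"
      by simp_all
  qed
  have det: "a * d - b * c \<noteq> 0"
  proof
    assume det0: "a * d - b * c = 0"
    obtain a' b' c' d' t' u' s' where Y: "(a', b', c', d', t', u', s') \<in> \<ss>"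
      and "d * (c' * d + d' * (- c)) - (- c) * (a' * d + b' * (- c)) \<noteq> 0"
      using irreducible[of d "- c"] c by auto
    moreover have "d * (c' * d + d' * (- c)) - (- c) * (a' * d + b' * (- c)) = 0"
      using comm(1,3)[OF Y] det0 by algebra
    ultimately show False by simp
  qed
  \<comment> \<open>Cramer's rule for the fixed point of the affine map with linear part \<open>A\<close> and translation \<open>(t, u)\<close>.\<close>
  define x where "x = - (d * t - b * u) / (a * d - b * c)"
  define y where "y = - (a * u - c * t) / (a * d - b * c)"
  have "x * (a * d - b * c) = - (d * t - b * u)" "y * (a * d - b * c) = - (a * u - c * t)"
    using det by (simp_all add: x_def y_def)
  then have "(a * d - b * c) * (a * x + b * y + t) = 0" "(a * d - b * c) * (c * x + d * y + u) = 0"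
    by algebra+
  then have xy: "a * x + b * y + t = 0" "c * x + d * y + u = 0"
    using det by simp_all
  have "a' * x + b' * y + t' = 0 \<and> c' * x + d' * y + u' = 0"
    if Y: "(a', b', c', d', t', u', s') \<in> \<ss>" for a' b' c' d' t' u' s'
  proof -
    have "a * (a' * x + b' * y + t') + b * (c' * x + d' * y + u') = 0"
         "c * (a' * x + b' * y + t') + d * (c' * x + d' * y + u') = 0"
      using comm[OF Y] xy by algebra+
    then have "(a * d - b * c) * (a' * x + b' * y + t') = 0" "(a * d - b * c) * (c' * x + d' * y + u') = 0"
      by algebra+
    then show ?thesis
      using det by simp
  qed
  then show ?thesis by blast
qed

text \<open>With the trace form, which pairs \<open>[X, Y]\<close> with \<open>Z\<close> as a determinant, \<open>sl(2)\<close> is a three-dimensional space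
  with cross product \<open>[X, Y]\<close>. If every element were orthogonal to \<open>N = [X, Y]\<close>, then \<open>N\<close> would be orthogonal
  to itself, hence nilpotent, and its kernel would be a common eigenline. So there is a \<open>Z\<close> that is not
  orthogonal to \<open>N\<close>, and \<open>[X, Y]\<close>, \<open>[Y, Z]\<close>, \<open>[Z, X]\<close> is, up to the factor \<open>D = tr (N Z)\<close>, the basis dual to \<open>Z\<close>,
  \<open>X\<close>, \<open>Y\<close>.\<close>

lemma contains_sl2:
  assumes X: "(xa, xb, xc, xd, xt, xu, xs) \<in> \<ss>" and Y: "(ya, yb, yc, yd, yt, yu, ys) \<in> \<ss>"
    and noncommuting: "\<not> (\<exists>t u s. parabolic_bracket (xa, xb, xc, xd, xt, xu, xs) (ya, yb, yc, yd, yt, yu, ys) = (0, 0, 0, 0, t, u, s))"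
  shows "\<exists>t u s. (p, q, r, - p, t, u, s) \<in> \<ss>"
proof -
  define n1 where "n1 = xb * yc - yb * xc"
  define n2 where "n2 = xa * yb + xb * yd - ya * xb - yb * xd"
  define n3 where "n3 = xc * ya + xd * yc - yc * xa - yd * xc"
  obtain nt nu ns where N: "parabolic_bracket (xa, xb, xc, xd, xt, xu, xs) (ya, yb, yc, yd, yt, yu, ys) = (n1, n2, n3, - n1, nt, nu, ns)"
    by (simp add: n1_def n2_def n3_def)
  have N': "(n1, n2, n3, - n1, nt, nu, ns) \<in> \<ss>"
    using bracket_closed[OF X Y] N by simp
  have "\<exists>a b c d t u s. (a, b, c, d, t, u, s) \<in> \<ss> \<and> n1 * a + n2 * c + n3 * b - n1 * d \<noteq> 0"
  proof (rule ccontr)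
    assume "\<not> ?thesis"
    then have orth: "n1 * a + n2 * c + n3 * b - n1 * d = 0" if "(a, b, c, d, t, u, s) \<in> \<ss>" for a b c d t u s
      using that by blast
    have nilpotent: "n1 * n1 + n2 * n3 = 0"
      using orth[OF N'] by simp
    show False
    proof (cases "n2 = 0")
      case True
      then have "n1 = 0" "n3 \<noteq> 0"
        using nilpotent noncommuting N by auto
      moreover obtain a b c d t u s where Z: "(a, b, c, d, t, u, s) \<in> \<ss>" and "b \<noteq> 0"
        using irreducible[of 0 1] by auto
      ultimately show False
        using orth[OF Z] True by simp
    next
      case False
      \<comment> \<open>The kernel of the nilpotent matrix \<open>N\<close> is spanned by \<open>(n2, - n1)\<close>.\<close>
      obtain a b c d t u s where Z: "(a, b, c, d, t, u, s) \<in> \<ss>"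
        and "n2 * (c * n2 + d * (- n1)) - (- n1) * (a * n2 + b * (- n1)) \<noteq> 0"
        using irreducible[of n2 "- n1"] False by auto
      moreover have "n2 * (c * n2 + d * (- n1)) - (- n1) * (a * n2 + b * (- n1)) = 0"
        using orth[OF Z] nilpotent by algebra
      ultimately show False by simp
    qed
  qed
  then obtain za zb zc zd zt zu zs where Z: "(za, zb, zc, zd, zt, zu, zs) \<in> \<ss>"
    and D0: "n1 * za + n2 * zc + n3 * zb - n1 * zd \<noteq> 0"
    by blast
  define D where "D = n1 * za + n2 * zc + n3 * zb - n1 * zd"
  \<comment> \<open>The coordinates of the matrix with rows \<open>(p, q)\<close> and \<open>(r, - p)\<close> in the dual basis.\<close>
  define \<alpha> where "\<alpha> = (p * za + q * zc + r * zb - p * zd) / D"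
  define \<beta> where "\<beta> = (p * xa + q * xc + r * xb - p * xd) / D"
  define \<gamma> where "\<gamma> = (p * ya + q * yc + r * yb - p * yd) / D"
  have D: "D \<noteq> 0"
    using D0 by (simp add: D_def)
  have \<alpha>: "\<alpha> * D = p * za + q * zc + r * zb - p * zd"
    and \<beta>: "\<beta> * D = p * xa + q * xc + r * xb - p * xd"
    and \<gamma>: "\<gamma> * D = p * ya + q * yc + r * yb - p * yd"
    using D by (simp_all add: \<alpha>_def \<beta>_def \<gamma>_def)
  have "D * (\<alpha> * n1 + \<beta> * (yb * zc - zb * yc) + \<gamma> * (zb * xc - xb * zc)) = D * p"
    using \<alpha> \<beta> \<gamma> D_def n1_def n2_def n3_def by algebra
  then have e1: "\<alpha> * n1 + \<beta> * (yb * zc - zb * yc) + \<gamma> * (zb * xc - xb * zc) = p"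
    using D by simp
  have "D * (\<alpha> * n2 + \<beta> * (ya * zb + yb * zd - za * yb - zb * yd) + \<gamma> * (za * xb + zb * xd - xa * zb - xb * zd)) = D * q"
    using \<alpha> \<beta> \<gamma> D_def n1_def n2_def n3_def by algebra
  then have e2: "\<alpha> * n2 + \<beta> * (ya * zb + yb * zd - za * yb - zb * yd) + \<gamma> * (za * xb + zb * xd - xa * zb - xb * zd) = q"
    using D by simp
  have "D * (\<alpha> * n3 + \<beta> * (yc * za + yd * zc - zc * ya - zd * yc) + \<gamma> * (zc * xa + zd * xc - xc * za - xd * zc)) = D * r"
    using \<alpha> \<beta> \<gamma> D_def n1_def n2_def n3_def by algebra
  then have e3: "\<alpha> * n3 + \<beta> * (yc * za + yd * zc - zc * ya - zd * yc) + \<gamma> * (zc * xa + zd * xc - xc * za - xd * zc) = r"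
    using D by simp
  have e4: "\<alpha> * (- n1) + \<beta> * (yc * zb - zc * yb) + \<gamma> * (zc * xb - xc * zb) = - p"
    using e1 by (simp add: algebra_simps)
  have "1 *\<^sub>R (\<alpha> *\<^sub>R (n1, n2, n3, - n1, nt, nu, ns)
      + \<beta> *\<^sub>R parabolic_bracket (ya, yb, yc, yd, yt, yu, ys) (za, zb, zc, zd, zt, zu, zs))
      + \<gamma> *\<^sub>R parabolic_bracket (za, zb, zc, zd, zt, zu, zs) (xa, xb, xc, xd, xt, xu, xs) \<in> \<ss>"
    by (intro combination N' bracket_closed X Y Z)
  then show ?thesis
    using e1 e2 e3 e4 by (auto simp: algebra_simps)
qed

text \<open>The brackets \<open>[H, E] = 2 E\<close>, \<open>[H, F] = - 2 F\<close> and \<open>[H, 1] = 0\<close> of the linear parts lift to the affine action,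
  because an element is determined by its linear part up to the centre of the Heisenberg algebra.
  Applied to the fixed point of \<open>H\<close> they say that \<open>H\<close> multiplies its displacement by \<open>E\<close>, \<open>F\<close> or a scalar
  by \<open>2\<close>, \<open>- 2\<close> or \<open>0\<close>. As \<open>H\<close> has only the eigenvalues \<open>1\<close> and \<open>- 1\<close> on the plane, the displacement
  is zero.\<close>

lemma common_fixed_point_sl2:
  assumes translation_free: "\<And>t u s. (0, 0, 0, 0, t, u, s) \<in> \<ss> \<Longrightarrow> t = 0 \<and> u = 0"
    and sl2: "\<And>p q r. \<exists>t u s. (p, q, r, - p, t, u, s) \<in> \<ss>"
  shows "\<exists>x y. \<forall>a b c d t u s. (a, b, c, d, t, u, s) \<in> \<ss> \<longrightarrow> a * x + b * y + t = 0 \<and> c * x + d * y + u = 0"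
proof -
  obtain ht hu hs where H: "(1, 0, 0, - 1, ht, hu, hs) \<in> \<ss>"
    using sl2[of 1 0 0] by auto
  \<comment> \<open>\<open>(- ht, hu)\<close> is the point of the affine plane fixed by \<open>H\<close>.\<close>
  have E: "et = - hu \<and> eu = 0" if "(0, 1, 0, 0, et, eu, es) \<in> \<ss>" for et eu es
    using combination[OF bracket_closed[OF H that] that, of 1 "-2"] translation_free by fastforce
  have F: "ft = 0 \<and> fu = ht" if "(0, 0, 1, 0, ft, fu, fs) \<in> \<ss>" for ft fu fs
    using combination[OF bracket_closed[OF H that] that, of 1 "2"] translation_free by fastforce
  have scalar: "t = m * ht \<and> u = - m * hu" if "(m, 0, 0, m, t, u, s) \<in> \<ss>" for m t u s
    using bracket_closed[OF H that] translation_free by fastforce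
  obtain et eu es where E': "(0, 1, 0, 0, et, eu, es) \<in> \<ss>"
    using sl2[of 0 1 0] by auto
  obtain ft fu fs where F': "(0, 0, 1, 0, ft, fu, fs) \<in> \<ss>"
    using sl2[of 0 0 1] by auto
  have "a * (- ht) + b * hu + t = 0 \<and> c * (- ht) + d * hu + u = 0"
    if Y: "(a, b, c, d, t, u, s) \<in> \<ss>" for a b c d t u s
  proof -
    have "1 *\<^sub>R (1 *\<^sub>R (1 *\<^sub>R (a, b, c, d, t, u, s) + (- b) *\<^sub>R (0, 1, 0, 0, et, eu, es))
      + (- c) *\<^sub>R (0, 0, 1, 0, ft, fu, fs)) + (- (a - d) / 2) *\<^sub>R (1, 0, 0, - 1, ht, hu, hs) \<in> \<ss>"
      by (intro combination Y E' F' H)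
    then have "((a + d) / 2, 0, 0, (a + d) / 2, t - b * et - c * ft - (a - d) / 2 * ht,
        u - b * eu - c * fu - (a - d) / 2 * hu, s - b * es - c * fs - (a - d) / 2 * hs) \<in> \<ss>"
      by (simp add: field_simps)
    from scalar[OF this] E[OF E'] F[OF F'] show ?thesis
      by (simp add: field_simps)
  qed
  then show ?thesis by blast
qed

text \<open>If the Heisenberg algebra is met only in its centre, the linear parts form an irreducible
  subalgebra of \<open>gl(2)\<close>. It is commutative or contains \<open>sl(2)\<close>, and in both cases every affine action with
  these linear parts has a fixed point.\<close>

lemma common_fixed_point_or_heisenberg:
  "(\<exists>x y. \<forall>a b c d t u s. (a, b, c, d, t, u, s) \<in> \<ss> \<longrightarrow> a * x + b * y + t = 0 \<and> c * x + d * y + u = 0) \<or>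
   (\<forall>t u s. (0, 0, 0, 0, t, u, s) \<in> \<ss>)"
proof (cases "\<exists>t u s. (0, 0, 0, 0, t, u, s) \<in> \<ss> \<and> (t \<noteq> 0 \<or> u \<noteq> 0)")
  case True
  then show ?thesis
    using heisenberg_subset by blast
next
  case translation_free: False
  show ?thesis
  proof (cases "\<forall>p\<in>\<ss>. \<forall>q\<in>\<ss>. \<exists>t u s. parabolic_bracket p q = (0, 0, 0, 0, t, u, s)")
    case True
    then show ?thesis
      using common_fixed_point_commuting translation_free by blast
  next
    case False
    then obtain p q where pq: "p \<in> \<ss>" "q \<in> \<ss>" "\<not> (\<exists>t u s. parabolic_bracket p q = (0, 0, 0, 0, t, u, s))"
      by blast
    obtain xa xb xc xd xt xu xs where p: "p = (xa, xb, xc, xd, xt, xu, xs)"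
      by (rule prod_cases7)
    obtain ya yb yc yd yt yu ys where q: "q = (ya, yb, yc, yd, yt, yu, ys)"
      by (rule prod_cases7)
    have "\<And>p q r. \<exists>t u s. (p, q, r, - p, t, u, s) \<in> \<ss>"
      by (rule contains_sl2[OF pq[unfolded p q]])
    then show ?thesis
      using common_fixed_point_sl2 translation_free by blast
  qed
qed

end


section \<open>Bases adapted to an isotropic plane\<close>

lemma exhaust_5:
  fixes i :: 5
  shows "i = 1 \<or> i = 2 \<or> i = 3 \<or> i = 4 \<or> i = 5"
proof (induct i)
  case (of_int z)
  then have "0 \<le> z" "z < 5"
    by simp_all
  then have "z = 0 \<or> z = 1 \<or> z = 2 \<or> z = 3 \<or> z = 4"
    by arith
  then show ?case by auto
qed

lemma vec5_eqI:
  fixes v w :: "'a^5"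
  assumes "v$1 = w$1" "v$2 = w$2" "v$3 = w$3" "v$4 = w$4" "v$5 = w$5"
  shows "v = w"
  unfolding vec_eq_iff
proof
  fix i show "v$i = w$i"
    using exhaust_5[of i] assms by (elim disjE) simp_all
qed

lemma bil_add_left: "bil (u + u') v = bil u v + bil u' v"
  and bil_add_right: "bil u (v + v') = bil u v + bil u v'"
  and bil_diff_left: "bil (u - u') v = bil u v - bil u' v"
  and bil_diff_right: "bil u (v - v') = bil u v - bil u v'"
  and bil_scaleR_left: "bil (c *\<^sub>R u) v = c * bil u v"
  and bil_scaleR_right: "bil u (c *\<^sub>R v) = c * bil u v"
  and bil_zero_left: "bil 0 v = 0"
  and bil_zero_right: "bil u 0 = 0"
  and bil_minus_left: "bil (- u) v = - bil u v"
  and bil_minus_right: "bil u (- v) = - bil u v"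
  by (simp_all add: bil_def algebra_simps)

lemmas bil_simps = bil_add_left bil_add_right bil_diff_left bil_diff_right bil_scaleR_left
  bil_scaleR_right bil_zero_left bil_zero_right bil_minus_left bil_minus_right

lemma bil_commute: "bil u v = bil v u"
  by (simp add: bil_def mult.commute)

lemma bil_polarization: "bil u v = (qf (u + v) - qf u - qf v) / 2"
  by (simp add: bil_def qf_def power2_eq_square algebra_simps)

lemma bounded_bilinear_bil: "bounded_bilinear bil"
  unfolding bilinear_conv_bounded_bilinear[symmetric] bilinear_def
  by (auto intro!: linearI simp: bil_simps)

lemma bil_nondegenerate:
  assumes "\<And>u. bil v u = 0"
  shows "v = 0"
proof -
  have "bil v (\<chi> i. if i = 1 \<or> i = 2 then - v$i else v$i) = 0"
    by (rule assms)
  then have "v$1 * v$1 + v$2 * v$2 + v$3 * v$3 + v$4 * v$4 + v$5 * v$5 = 0"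
    by (simp add: bil_def)
  then have "v$1 = 0 \<and> v$2 = 0 \<and> v$3 = 0 \<and> v$4 = 0 \<and> v$5 = 0"
    by (simp add: add_nonneg_eq_0_iff)
  then show ?thesis
    by (intro vec5_eqI) auto
qed

lemma solve_linear_system_2:
  fixes a b c d r s :: real
  assumes "a * d - b * c \<noteq> 0"
  obtains x y where "a * x + b * y = r" "c * x + d * y = s"
proof
  let ?D = "a * d - b * c"
  define x where "x = (r * d - b * s) / ?D"
  define y where "y = (a * s - r * c) / ?D"
  have "x * ?D = r * d - b * s" "y * ?D = a * s - r * c"
    using assms by (simp_all add: x_def y_def)
  then have "?D * (a * x + b * y - r) = 0" "?D * (c * x + d * y - s) = 0"
    by algebra+
  then show "a * x + b * y = r" "c * x + d * y = s"
    using assms by simp_all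
qed

locale witt_basis =
  fixes e1 e2 e0 f1 f2 :: "real^5"
  assumes bil_basis_upper:
    "bil e1 e1 = 0" "bil e1 e2 = 0" "bil e1 e0 = 0" "bil e1 f1 = 1" "bil e1 f2 = 0"
    "bil e2 e2 = 0" "bil e2 e0 = 0" "bil e2 f1 = 0" "bil e2 f2 = 1"
    "bil e0 e0 = 1" "bil e0 f1 = 0" "bil e0 f2 = 0"
    "bil f1 f1 = 0" "bil f1 f2 = 0" "bil f2 f2 = 0"
begin

lemma bil_basis_lower:
  "bil e2 e1 = 0" "bil e0 e1 = 0" "bil f1 e1 = 1" "bil f2 e1 = 0"
  "bil e0 e2 = 0" "bil f1 e2 = 0" "bil f2 e2 = 1" "bil f1 e0 = 0" "bil f2 e0 = 0" "bil f2 f1 = 0"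
  using bil_basis_upper by (simp_all add: bil_commute)

lemmas bil_basis = bil_basis_upper bil_basis_lower

text \<open>The five vectors are independent since their pairings recover the coefficients, hence they are a basis.\<close>

lemma expansion:
  "v = bil v f1 *\<^sub>R e1 + bil v f2 *\<^sub>R e2 + bil v e0 *\<^sub>R e0 + bil v e1 *\<^sub>R f1 + bil v e2 *\<^sub>R f2"
proof -
  define F :: "real^5 \<Rightarrow> real^5"
    where "F x = x$1 *\<^sub>R e1 + x$2 *\<^sub>R e2 + x$3 *\<^sub>R e0 + x$4 *\<^sub>R f1 + x$5 *\<^sub>R f2" for x
  have coordinates: "bil (F x) f1 = x$1" "bil (F x) f2 = x$2" "bil (F x) e0 = x$3"
      "bil (F x) e1 = x$4" "bil (F x) e2 = x$5" for x
    by (simp_all add: F_def bil_simps bil_basis)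
  have "linear F"
    by (rule linearI) (simp_all add: F_def algebra_simps)
  moreover have "inj F"
    by (rule injI, rule vec5_eqI) (metis coordinates)+
  ultimately have "surj F"
    by (rule linear_injective_imp_surjective) simp
  then obtain x where "v = F x"
    by blast
  then show ?thesis
    unfolding coordinates \<open>v = F x\<close> by (rule subst) (simp add: F_def)
qed

lemma eqI:
  assumes "bil v e1 = bil w e1" "bil v e2 = bil w e2" "bil v e0 = bil w e0"
    "bil v f1 = bil w f1" "bil v f2 = bil w f2"
  shows "v = w"
  using expansion[of v] expansion[of w] assms by simp

text \<open>Here \<open>P\<close> is spanned by \<open>e1\<close> and \<open>e2\<close>, and the matrix acts on \<open>f1\<close>, \<open>f2\<close> by the negative
  transpose of \<open>A\<close>, modulo the span of \<open>e1\<close>, \<open>e2\<close> and \<open>e0\<close>.\<close>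

definition infinitesimal :: "parabolic \<Rightarrow> real^5^5" where
  "infinitesimal = (\<lambda>(a, b, c, d, t, u, s). matrix (\<lambda>v.
     (a * bil v f1 + b * bil v f2 + t * bil v e0 - s * bil v e2) *\<^sub>R e1
   + (c * bil v f1 + d * bil v f2 + u * bil v e0 + s * bil v e1) *\<^sub>R e2
   - (t * bil v e1 + u * bil v e2) *\<^sub>R e0
   - (a * bil v e1 + c * bil v e2) *\<^sub>R f1
   - (b * bil v e1 + d * bil v e2) *\<^sub>R f2))"

lemma infinitesimal_apply:
  "infinitesimal (a, b, c, d, t, u, s) *v v =
     (a * bil v f1 + b * bil v f2 + t * bil v e0 - s * bil v e2) *\<^sub>R e1
   + (c * bil v f1 + d * bil v f2 + u * bil v e0 + s * bil v e1) *\<^sub>R e2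
   - (t * bil v e1 + u * bil v e2) *\<^sub>R e0
   - (a * bil v e1 + c * bil v e2) *\<^sub>R f1
   - (b * bil v e1 + d * bil v e2) *\<^sub>R f2"
proof -
  have "linear (\<lambda>v. (a * bil v f1 + b * bil v f2 + t * bil v e0 - s * bil v e2) *\<^sub>R e1
   + (c * bil v f1 + d * bil v f2 + u * bil v e0 + s * bil v e1) *\<^sub>R e2
   - (t * bil v e1 + u * bil v e2) *\<^sub>R e0
   - (a * bil v e1 + c * bil v e2) *\<^sub>R f1
   - (b * bil v e1 + d * bil v e2) *\<^sub>R f2)"
    by (rule linearI) (simp_all add: bil_simps algebra_simps)
  then show ?thesis
    by (simp add: infinitesimal_def matrix_works)
qed

lemma infinitesimal_add: "infinitesimal (p + q) = infinitesimal p + infinitesimal q"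
  unfolding matrix_eq
  by (cases p; cases q) (simp add: infinitesimal_apply algebra_simps)

lemma infinitesimal_scaleR: "infinitesimal (r *\<^sub>R p) = r *\<^sub>R infinitesimal p"
  unfolding matrix_eq
  by (cases p) (simp add: infinitesimal_apply scaleR_matrix_vector_assoc[symmetric] algebra_simps)

lemma infinitesimal_bracket:
  "infinitesimal p ** infinitesimal q - infinitesimal q ** infinitesimal p = infinitesimal (parabolic_bracket p q)"
  unfolding matrix_eq
proof
  fix v
  show "(infinitesimal p ** infinitesimal q - infinitesimal q ** infinitesimal p) *v v = infinitesimal (parabolic_bracket p q) *v v"
    by (cases p; cases q; rule eqI)
      (simp_all add: infinitesimal_apply matrix_vector_mul_assoc[symmetric] matrix_vector_mult_diff_rdistrib
        bil_simps bil_basis algebra_simps)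
qed

lemma isotropic_plane_iff:
  "v \<in> span {e1, e2} \<longleftrightarrow> bil v e1 = 0 \<and> bil v e2 = 0 \<and> bil v e0 = 0"
proof
  assume "v \<in> span {e1, e2}"
  then show "bil v e1 = 0 \<and> bil v e2 = 0 \<and> bil v e0 = 0"
    by (induction rule: span_induct_alt) (simp_all add: bil_simps bil_basis, (auto simp: bil_basis)?)
next
  assume "bil v e1 = 0 \<and> bil v e2 = 0 \<and> bil v e0 = 0"
  then have "v = bil v f1 *\<^sub>R e1 + bil v f2 *\<^sub>R e2"
    using expansion[of v] by simp
  also have "\<dots> \<in> span {e1, e2}"
    by (intro span_add span_scale span_base) auto
  finally show "v \<in> span {e1, e2}" .
qed

text \<open>Subtracting \<open>k\<close> leaves a skew matrix. Skewness and the invariance of the plane determine all entries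
  from the seven that are taken as parameters.\<close>

lemma infinitesimal_of_similarity:
  assumes similarity: "\<And>u v. bil (X *v u) v + bil u (X *v v) = 2 * k * bil u v"
    and stable: "X *v e1 \<in> span {e1, e2}" "X *v e2 \<in> span {e1, e2}"
  obtains p where "X = infinitesimal p + k *\<^sub>R mat 1"
proof
  define Y where "Y = X - k *\<^sub>R mat 1"
  have Y_apply: "Y *v v = X *v v - k *\<^sub>R v" for v
    by (simp add: Y_def matrix_vector_mult_diff_rdistrib scaleR_matrix_vector_assoc[symmetric])
  have skew: "bil (Y *v u) v = - bil (Y *v v) u" for u v
    using similarity[of u v] bil_commute[of u "X *v v"] bil_commute[of u v]
    by (simp add: Y_apply bil_simps)
  have diag: "bil (Y *v u) u = 0" for u
    using skew[of u u] by simp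
  have zero: "bil (Y *v e1) e1 = 0" "bil (Y *v e1) e2 = 0" "bil (Y *v e1) e0 = 0"
      "bil (Y *v e2) e1 = 0" "bil (Y *v e2) e2 = 0" "bil (Y *v e2) e0 = 0"
    using stable by (simp_all add: Y_apply isotropic_plane_iff bil_simps bil_basis)
  define a b c d t u s where
    abcd: "a = bil (Y *v e1) f1" "b = bil (Y *v e2) f1" "c = bil (Y *v e1) f2" "d = bil (Y *v e2) f2"
    and tus: "t = bil (Y *v e0) f1" "u = bil (Y *v e0) f2" "s = bil (Y *v f1) f2"
  have coefficients: "bil (Y *v e0) e1 = 0" "bil (Y *v e0) e2 = 0"
      "bil (Y *v f1) e1 = - a" "bil (Y *v f1) e2 = - b" "bil (Y *v f1) e0 = - t"
      "bil (Y *v f2) e1 = - c" "bil (Y *v f2) e2 = - d" "bil (Y *v f2) e0 = - u" "bil (Y *v f2) f1 = - s"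
    using skew[of e0 e1] skew[of e0 e2] skew[of f1 e1] skew[of f1 e2] skew[of f1 e0]
      skew[of f2 e1] skew[of f2 e2] skew[of f2 e0] skew[of f2 f1]
    by (simp_all add: zero abcd tus)
  have basis: "Y *v e1 = a *\<^sub>R e1 + c *\<^sub>R e2" "Y *v e2 = b *\<^sub>R e1 + d *\<^sub>R e2"
     "Y *v e0 = t *\<^sub>R e1 + u *\<^sub>R e2"
     "Y *v f1 = s *\<^sub>R e2 - t *\<^sub>R e0 - a *\<^sub>R f1 - b *\<^sub>R f2"
     "Y *v f2 = - s *\<^sub>R e1 - u *\<^sub>R e0 - c *\<^sub>R f1 - d *\<^sub>R f2"
    by (rule eqI; simp add: bil_simps bil_basis zero coefficients diag abcd tus)+
  have "Y *v v = infinitesimal (a, b, c, d, t, u, s) *v v" for v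
  proof -
    have "Y *v v = Y *v (bil v f1 *\<^sub>R e1 + bil v f2 *\<^sub>R e2 + bil v e0 *\<^sub>R e0 + bil v e1 *\<^sub>R f1 + bil v e2 *\<^sub>R f2)"
      using expansion[of v] by simp
    then show ?thesis
      by (simp add: matrix_vector_right_distrib matrix_vector_mult_scaleR basis infinitesimal_apply algebra_simps)
  qed
  then have "Y = infinitesimal (a, b, c, d, t, u, s)"
    by (simp add: matrix_eq)
  then show "X = infinitesimal (a, b, c, d, t, u, s) + k *\<^sub>R mat 1"
    by (simp add: Y_def algebra_simps)
qed

end

text \<open>The form is definite on the vectors with vanishing first two coordinates, so these two coordinates
  identify the plane with \<open>\<real>\<^sup>2\<close>. Isotropy then makes the remaining three coordinates of the basis
  \<open>(1, 0, _)\<close>, \<open>(0, 1, _)\<close> an orthonormal pair in \<open>\<real>\<^sup>3\<close>, which a cross product completes.\<close>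

lemma witt_basis_of_isotropic_plane:
  assumes P: "subspace P" "dim P = 2" and isotropic: "\<And>u v. u \<in> P \<Longrightarrow> v \<in> P \<Longrightarrow> bil u v = 0"
  obtains e1 e2 e0 f1 f2 where "witt_basis e1 e2 e0 f1 f2" "P = span {e1, e2}"
proof -
  define \<pi> :: "real^5 \<Rightarrow> real^2" where "\<pi> v = (\<chi> i. if i = 1 then v$1 else v$2)" for v
  have \<pi>1: "\<pi> v $ 1 = v$1" and \<pi>2: "\<pi> v $ 2 = v$2" for v
    by (simp_all add: \<pi>_def)
  have "linear \<pi>"
    by (rule linearI) (simp_all add: \<pi>_def vec_eq_iff)
  have definite: "v = 0" if "v \<in> P" "v$1 = 0" "v$2 = 0" for v
  proof -
    have "v$3 * v$3 + v$4 * v$4 + v$5 * v$5 = 0"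
      using isotropic[of v v] that by (simp add: bil_def)
    then have "v$3 = 0 \<and> v$4 = 0 \<and> v$5 = 0"
      by (simp add: add_nonneg_eq_0_iff)
    with that show ?thesis
      by (intro vec5_eqI) auto
  qed
  have "inj_on \<pi> P"
  proof (rule inj_onI)
    fix v w assume "v \<in> P" "w \<in> P" "\<pi> v = \<pi> w"
    then have "v$1 = w$1" "v$2 = w$2"
      by (metis \<pi>1, metis \<pi>2)
    then have "v - w = 0"
      using \<open>v \<in> P\<close> \<open>w \<in> P\<close> by (intro definite subspace_diff P) auto
    then show "v = w" by simp
  qed
  then have "dim (\<pi> ` P) = 2"
    using dim_image_eq[OF \<open>linear \<pi>\<close>, of P] P by (simp add: span_eq_iff[THEN iffD2])
  then have "\<pi> ` P = UNIV"
    using dim_eq_full[of "\<pi> ` P"] span_eq_iff[THEN iffD2, OF linear_subspace_image[OF \<open>linear \<pi>\<close> P(1)]]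
    by simp
  then have onto: "\<exists>v\<in>P. v$1 = x \<and> v$2 = y" for x y
  proof -
    have "(\<chi> i. if i = 1 then x else y) \<in> \<pi> ` P"
      using \<open>\<pi> ` P = UNIV\<close> by simp
    then obtain v where "v \<in> P" and v: "(\<chi> i. if i = 1 then x else y) = \<pi> v"
      by blast
    moreover have "v$1 = x" "v$2 = y"
      using \<pi>1[of v] \<pi>2[of v] by (simp_all flip: v)
    ultimately show ?thesis by blast
  qed
  obtain e1 where e1: "e1 \<in> P" "e1$1 = 1" "e1$2 = 0"
    using onto by blast
  obtain e2 where e2: "e2 \<in> P" "e2$1 = 0" "e2$2 = 1"
    using onto by blast
  have norm1: "(e1$3)^2 + (e1$4)^2 + (e1$5)^2 = 1" and norm2: "(e2$3)^2 + (e2$4)^2 + (e2$5)^2 = 1"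
    and orth: "e1$3 * e2$3 + e1$4 * e2$4 + e1$5 * e2$5 = 0"
    using isotropic[OF e1(1) e1(1)] isotropic[OF e2(1) e2(1)] isotropic[OF e1(1) e2(1)] e1 e2
    by (simp_all add: bil_def power2_eq_square)
  define e0 :: "real^5" where "e0 = (\<chi> i. if i = 3 then e1$4 * e2$5 - e1$5 * e2$4 else
      if i = 4 then e1$5 * e2$3 - e1$3 * e2$5 else if i = 5 then e1$3 * e2$4 - e1$4 * e2$3 else 0)"
  define f1 :: "real^5" where "f1 = (1/2) *\<^sub>R (\<chi> i. if i = 1 then - 1 else e1$i)"
  define f2 :: "real^5" where "f2 = (1/2) *\<^sub>R (\<chi> i. if i = 2 then - 1 else e2$i)"
  have e0: "e0$1 = 0" "e0$2 = 0" "e0$3 = e1$4 * e2$5 - e1$5 * e2$4"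
    "e0$4 = e1$5 * e2$3 - e1$3 * e2$5" "e0$5 = e1$3 * e2$4 - e1$4 * e2$3"
    by (simp_all add: e0_def)
  have "(e1$4 * e2$5 - e1$5 * e2$4)^2 + (e1$5 * e2$3 - e1$3 * e2$5)^2 + (e1$3 * e2$4 - e1$4 * e2$3)^2 = 1"
    using norm1 norm2 orth by algebra
  then have "witt_basis e1 e2 e0 f1 f2"
    using norm1 norm2 orth
    by unfold_locales
      (simp_all add: bil_def e0 f1_def f2_def e1 e2 power2_eq_square algebra_simps)
  moreover have "P = span {e1, e2}"
  proof
    show "span {e1, e2} \<subseteq> P"
      using e1 e2 P by (intro span_minimal) auto
    show "P \<subseteq> span {e1, e2}"
    proof
      fix v assume "v \<in> P"
      then have "v - v$1 *\<^sub>R e1 - v$2 *\<^sub>R e2 = 0"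
        using e1 e2 by (intro definite subspace_diff subspace_scale P) auto
      then have "v = v$1 *\<^sub>R e1 + v$2 *\<^sub>R e2"
        by (simp add: algebra_simps)
      also have "\<dots> \<in> span {e1, e2}"
        by (intro span_add span_scale span_base) auto
      finally show "v \<in> span {e1, e2}" .
    qed
  qed
  ultimately show thesis
    using that by blast
qed


section \<open>Invariant lines and open orbits of a Lie algebra\<close>

context witt_basis
begin

lemma infinitesimal_zero: "infinitesimal 0 = 0"
  using infinitesimal_scaleR[of 0 0] by simp

text \<open>The directions \<open>X p\<close> and \<open>p\<close> itself span the hyperplane \<open>p\<^sup>\<perp>\<close>, so a fifth vector completes them to a spanning
  set. Let \<open>(x, y) \<noteq> 0\<close> be the coordinates of \<open>p\<close> on \<open>f1\<close>, \<open>f2\<close>. The system is triangular: \<open>X3\<close>, chosen to move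
  the line of \<open>P\<close> orthogonal to \<open>p\<close>, and \<open>p\<close> account for the coefficients on \<open>f1\<close>, \<open>f2\<close>; the translation
  \<open>X2\<close> by \<open>(x, y)\<close> for that on \<open>e0\<close>; the centre \<open>X1\<close> and the transversal for those on \<open>e1\<close>, \<open>e2\<close>.\<close>

lemma orbit_directions_with_transversal:
  assumes "parabolic_subalgebra \<ss>" and heisenberg: "\<And>t u s. (0, 0, 0, 0, t, u, s) \<in> \<ss>"
    and null: "qf p = 0" and "p \<notin> span {e1, e2}"
    and sub: "infinitesimal ` \<ss> \<subseteq> \<gg>"
  shows "\<exists>X1\<in>\<gg>. \<exists>X2\<in>\<gg>. \<exists>X3\<in>\<gg>. \<exists>e. \<forall>w.
    \<exists>t1 t2 t3 t4 r. w = t1 *\<^sub>R (X1 *v p) + t2 *\<^sub>R (X2 *v p) + t3 *\<^sub>R (X3 *v p) + t4 *\<^sub>R p + r *\<^sub>R e"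
proof -
  interpret parabolic_subalgebra \<ss> by fact
  define x y where "x = bil p e1" and "y = bil p e2"
  have qf_p: "2 * (bil p f1 * x + bil p f2 * y) + (bil p e0)^2 = 0"
  proof -
    have "bil p p = bil p (bil p f1 *\<^sub>R e1 + bil p f2 *\<^sub>R e2 + bil p e0 *\<^sub>R e0 + bil p e1 *\<^sub>R f1 + bil p e2 *\<^sub>R f2)"
      using expansion[of p] by simp
    then show ?thesis
      using null by (simp add: qf_eq_bil bil_simps x_def y_def power2_eq_square algebra_simps)
  qed
  have xy: "x \<noteq> 0 \<or> y \<noteq> 0"
  proof (rule ccontr)
    assume "\<not> ?thesis"
    with qf_p have "p \<in> span {e1, e2}"
      by (simp add: isotropic_plane_iff x_def y_def)
    with assms(4) show False by simp
  qed
  then have square: "x * x + y * y \<noteq> 0"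
    by (metis sum_squares_eq_zero_iff)
  obtain a b c d t u s where X3: "(a, b, c, d, t, u, s) \<in> \<ss>"
    and "- y * (c * (- y) + d * x) - x * (a * (- y) + b * x) \<noteq> 0"
    using irreducible[of "- y" x] xy by auto
  then have det: "(- (a * x + c * y)) * y - x * (- (b * x + d * y)) \<noteq> 0"
    by (simp add: algebra_simps)
  show ?thesis
  proof (intro bexI exI[of _ "x *\<^sub>R e1 + y *\<^sub>R e2"] allI)
    fix w
    let ?X1 = "infinitesimal (0, 0, 0, 0, 0, 0, 1)"
    let ?X2 = "infinitesimal (0, 0, 0, 0, x, y, 0)"
    let ?X3 = "infinitesimal (a, b, c, d, t, u, s)"
    let ?e = "x *\<^sub>R e1 + y *\<^sub>R e2"
    obtain t3 t4 where f: "(- (a * x + c * y)) * t3 + x * t4 = bil w e1" "(- (b * x + d * y)) * t3 + y * t4 = bil w e2"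
      by (rule solve_linear_system_2) (use det in auto)
    define t2 where "t2 = (t3 * bil (?X3 *v p) e0 + t4 * bil p e0 - bil w e0) / (x * x + y * y)"
    have t2: "t2 * (x * x + y * y) = t3 * bil (?X3 *v p) e0 + t4 * bil p e0 - bil w e0"
      using square by (simp add: t2_def)
    have "(- y) * y - x * x = - (x * x + y * y)"
      by simp
    with square have "(- y) * y - x * x \<noteq> 0"
      by (simp only: neg_equal_0_iff_equal not_False_eq_True)
    then obtain t1 r
      where e: "(- y) * t1 + x * r = bil (w - t2 *\<^sub>R (?X2 *v p) - t3 *\<^sub>R (?X3 *v p) - t4 *\<^sub>R p) f1"
        "x * t1 + y * r = bil (w - t2 *\<^sub>R (?X2 *v p) - t3 *\<^sub>R (?X3 *v p) - t4 *\<^sub>R p) f2"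
      by (rule solve_linear_system_2)
    have "w = t1 *\<^sub>R (?X1 *v p) + t2 *\<^sub>R (?X2 *v p) + t3 *\<^sub>R (?X3 *v p) + t4 *\<^sub>R p + r *\<^sub>R ?e"
    proof (rule eqI)
      show "bil w f1 = bil (t1 *\<^sub>R (?X1 *v p) + t2 *\<^sub>R (?X2 *v p) + t3 *\<^sub>R (?X3 *v p) + t4 *\<^sub>R p + r *\<^sub>R ?e) f1"
        using e(1) by (simp add: infinitesimal_apply bil_simps bil_basis algebra_simps flip: x_def y_def)
      show "bil w f2 = bil (t1 *\<^sub>R (?X1 *v p) + t2 *\<^sub>R (?X2 *v p) + t3 *\<^sub>R (?X3 *v p) + t4 *\<^sub>R p + r *\<^sub>R ?e) f2"
        using e(2) by (simp add: infinitesimal_apply bil_simps bil_basis algebra_simps flip: x_def y_def)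
      show "bil w e0 = bil (t1 *\<^sub>R (?X1 *v p) + t2 *\<^sub>R (?X2 *v p) + t3 *\<^sub>R (?X3 *v p) + t4 *\<^sub>R p + r *\<^sub>R ?e) e0"
        using t2 by (simp add: infinitesimal_apply bil_simps bil_basis algebra_simps flip: x_def y_def)
      show "bil w e1 = bil (t1 *\<^sub>R (?X1 *v p) + t2 *\<^sub>R (?X2 *v p) + t3 *\<^sub>R (?X3 *v p) + t4 *\<^sub>R p + r *\<^sub>R ?e) e1"
        using f(1) by (simp add: infinitesimal_apply bil_simps bil_basis algebra_simps flip: x_def y_def)
      show "bil w e2 = bil (t1 *\<^sub>R (?X1 *v p) + t2 *\<^sub>R (?X2 *v p) + t3 *\<^sub>R (?X3 *v p) + t4 *\<^sub>R p + r *\<^sub>R ?e) e2"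
        using f(2) by (simp add: infinitesimal_apply bil_simps bil_basis algebra_simps flip: x_def y_def)
    qed
    then show "\<exists>t1 t2 t3 t4 r. w = t1 *\<^sub>R (?X1 *v p) + t2 *\<^sub>R (?X2 *v p) + t3 *\<^sub>R (?X3 *v p) + t4 *\<^sub>R p + r *\<^sub>R ?e"
      by blast
  qed (use X3 heisenberg sub in auto)
qed

text \<open>A common eigenvector in \<open>P\<close> is an invariant line. Otherwise the affine action on \<open>e0 + P\<close> has a common
  fixed point, which is killed by the skew parts and so spans an invariant line, or the whole Heisenberg
  algebra is present and the infinitesimal orbits off \<open>P\<close> are as large as possible.\<close>

lemma invariant_line_or_open_orbits:
  assumes sub: "subspace \<gg>" and one: "mat 1 \<in> \<gg>"
    and bracket: "\<And>X Y. X \<in> \<gg> \<Longrightarrow> Y \<in> \<gg> \<Longrightarrow> X ** Y - Y ** X \<in> \<gg>"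
    and similarity: "\<And>X. X \<in> \<gg> \<Longrightarrow> \<exists>k. \<forall>u v. bil (X *v u) v + bil u (X *v v) = 2 * k * bil u v"
    and stable: "\<And>X v. X \<in> \<gg> \<Longrightarrow> v \<in> span {e1, e2} \<Longrightarrow> X *v v \<in> span {e1, e2}"
  shows "(\<exists>v. v \<noteq> 0 \<and> (\<forall>X\<in>\<gg>. X *v v \<in> span {v})) \<or>
    (\<forall>p. qf p = 0 \<longrightarrow> p \<notin> span {e1, e2} \<longrightarrow>
      (\<exists>X1\<in>\<gg>. \<exists>X2\<in>\<gg>. \<exists>X3\<in>\<gg>. \<exists>e. \<forall>w.
        \<exists>t1 t2 t3 t4 r. w = t1 *\<^sub>R (X1 *v p) + t2 *\<^sub>R (X2 *v p) + t3 *\<^sub>R (X3 *v p) + t4 *\<^sub>R p + r *\<^sub>R e))"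
proof -
  define \<ss> where "\<ss> = infinitesimal -` \<gg>"
  have sub_\<ss>: "subspace \<ss>"
    unfolding \<ss>_def using sub
    by (intro subspaceI) (auto simp: infinitesimal_zero infinitesimal_add infinitesimal_scaleR
        subspace_0 subspace_add subspace_scale)
  have bracket_\<ss>: "parabolic_bracket p q \<in> \<ss>" if "p \<in> \<ss>" "q \<in> \<ss>" for p q
    using bracket that by (auto simp: \<ss>_def simp flip: infinitesimal_bracket)
  have decompose: "\<exists>a b c d t u s k. (a, b, c, d, t, u, s) \<in> \<ss> \<and> X = infinitesimal (a, b, c, d, t, u, s) + k *\<^sub>R mat 1"
    if X: "X \<in> \<gg>" for X
  proof -
    obtain k where k: "\<And>u v. bil (X *v u) v + bil u (X *v v) = 2 * k * bil u v"
      using similarity[OF X] by blast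
    have "X *v e1 \<in> span {e1, e2}" "X *v e2 \<in> span {e1, e2}"
      by (intro stable[OF X] span_base; simp)+
    then obtain q where q: "X = infinitesimal q + k *\<^sub>R mat 1"
      by (rule infinitesimal_of_similarity[OF k])
    then have "infinitesimal q = X - k *\<^sub>R mat 1"
      by simp
    then have "q \<in> \<ss>"
      using X one sub by (auto simp: \<ss>_def intro!: subspace_diff subspace_scale)
    then show ?thesis
      using q by (cases q) blast
  qed
  have lineI: "\<forall>X\<in>\<gg>. X *v v \<in> span {v}"
    if "\<And>a b c d t u s. (a, b, c, d, t, u, s) \<in> \<ss> \<Longrightarrow> infinitesimal (a, b, c, d, t, u, s) *v v \<in> span {v}" for v
  proof
    fix X assume "X \<in> \<gg>"
    then obtain a b c d t u s k where "(a, b, c, d, t, u, s) \<in> \<ss>" and X: "X = infinitesimal (a, b, c, d, t, u, s) + k *\<^sub>R mat 1"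
      using decompose by blast
    with that have "infinitesimal (a, b, c, d, t, u, s) *v v + k *\<^sub>R v \<in> span {v}"
      by (intro span_add[OF _ span_scale[OF span_base]]) auto
    then show "X *v v \<in> span {v}"
      by (simp add: X matrix_vector_mult_add_rdistrib scaleR_matrix_vector_assoc[symmetric])
  qed
  show ?thesis
  proof (cases "\<forall>x y. x \<noteq> 0 \<or> y \<noteq> 0 \<longrightarrow>
      (\<exists>a b c d t u s. (a, b, c, d, t, u, s) \<in> \<ss> \<and> x * (c * x + d * y) - y * (a * x + b * y) \<noteq> 0)")
    case False
    then obtain x y where xy: "x \<noteq> 0 \<or> y \<noteq> 0"
      and no_move: "\<not> (\<exists>a b c d t u s. (a, b, c, d, t, u, s) \<in> \<ss> \<and> x * (c * x + d * y) - y * (a * x + b * y) \<noteq> 0)"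
      by (metis (no_types, lifting))
    from no_move have wedge: "x * (c * x + d * y) - y * (a * x + b * y) = 0"
      if "(a, b, c, d, t, u, s) \<in> \<ss>" for a b c d t u s
      using that by blast
    define v where "v = x *\<^sub>R e1 + y *\<^sub>R e2"
    have square: "x * x + y * y \<noteq> 0"
      using xy by (metis sum_squares_eq_zero_iff)
    have "infinitesimal (a, b, c, d, t, u, s) *v v \<in> span {v}" if "(a, b, c, d, t, u, s) \<in> \<ss>" for a b c d t u s
    proof -
      define l where "l = (x * (a * x + b * y) + y * (c * x + d * y)) / (x * x + y * y)"
      have l: "l * (x * x + y * y) = x * (a * x + b * y) + y * (c * x + d * y)"
        using square by (simp add: l_def)
      have "(x * x + y * y) * (a * x + b * y - l * x) = 0" "(x * x + y * y) * (c * x + d * y - l * y) = 0"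
        using l wedge[OF that] by algebra+
      then have "a * x + b * y = l * x" "c * x + d * y = l * y"
        using square by (metis eq_iff_diff_eq_0 mult_eq_0_iff)+
      then have "infinitesimal (a, b, c, d, t, u, s) *v v = l *\<^sub>R v"
        by (simp add: infinitesimal_apply v_def bil_simps bil_basis scaleR_right_distrib)
      then show ?thesis
        by (simp add: span_base span_scale)
    qed
    moreover have "v \<noteq> 0"
    proof
      assume "v = 0"
      then have "bil v f1 = 0" "bil v f2 = 0" by (simp_all add: bil_simps)
      with xy show False by (simp add: v_def bil_simps bil_basis)
    qed
    ultimately show ?thesis
      using lineI by blast
  next
    case True
    have subalgebra: "parabolic_subalgebra \<ss>"
      by (rule parabolic_subalgebra.intro[OF sub_\<ss> bracket_\<ss>]) (assumption | rule True[rule_format])+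
    from parabolic_subalgebra.common_fixed_point_or_heisenberg[OF subalgebra] show ?thesis
    proof
      assume "\<exists>x y. \<forall>a b c d t u s. (a, b, c, d, t, u, s) \<in> \<ss> \<longrightarrow> a * x + b * y + t = 0 \<and> c * x + d * y + u = 0"
      then obtain x y where xy: "\<And>a b c d t u s. (a, b, c, d, t, u, s) \<in> \<ss> \<Longrightarrow> a * x + b * y + t = 0 \<and> c * x + d * y + u = 0"
        by blast
      define v where "v = x *\<^sub>R e1 + y *\<^sub>R e2 + e0"
      have "infinitesimal (a, b, c, d, t, u, s) *v v \<in> span {v}" if "(a, b, c, d, t, u, s) \<in> \<ss>" for a b c d t u s
        using xy[OF that] by (simp add: infinitesimal_apply v_def bil_simps bil_basis span_zero)
      moreover have "v \<noteq> 0"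
      proof
        assume "v = 0"
        then have "bil v e0 = 0" by (simp add: bil_simps)
        then show False by (simp add: v_def bil_simps bil_basis)
      qed
      ultimately show ?thesis
        using lineI by blast
    next
      assume heisenberg: "\<forall>t u s. (0, 0, 0, 0, t, u, s) \<in> \<ss>"
      have "infinitesimal ` \<ss> \<subseteq> \<gg>"
        by (auto simp: \<ss>_def)
      then show ?thesis
        using heisenberg by (intro disjI2 allI impI orbit_directions_with_transversal[OF subalgebra]) auto
    qed
  qed
qed

end


section \<open>Charts, and lines invariant under a connected group\<close>

lemma span_singleton_cong:
  fixes v w :: "'a::real_vector"
  assumes "w \<in> span {v}" "w \<noteq> 0"
  shows "span {w} = span {v}"
proof -
  obtain c where c: "w = c *\<^sub>R v"
    using assms(1) by (auto simp: span_singleton)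
  then have "c \<noteq> 0"
    using assms(2) by auto
  then have "v = (1 / c) *\<^sub>R w"
    by (simp add: c)
  then have "v \<in> span {w}"
    by (metis span_base span_scale singletonI)
  then show ?thesis
    using assms(1) by (simp add: span_eq)
qed

text \<open>The cone over a set of projective points, without its vertex.\<close>

definition lifts :: "'a::real_vector set set \<Rightarrow> 'a set" where
  "lifts S = {v. v \<noteq> 0 \<and> span {v} \<in> S}"

lemma act_span: "act (span {A}) (span {x}) = span {A *v x}"
proof -
  have "act (span {A}) (span {x}) = {(c *\<^sub>R A) *v (d *\<^sub>R x) | c d. True}"
    by (auto simp: act_def span_singleton)
  also have "\<dots> = range (\<lambda>c. c *\<^sub>R (A *v x))"
  proof
    show "{(c *\<^sub>R A) *v (d *\<^sub>R x) | c d. True} \<subseteq> range (\<lambda>c. c *\<^sub>R (A *v x))"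
      by (auto simp: matrix_vector_scaleR_left matrix_vector_scaleR_right)
    show "range (\<lambda>c. c *\<^sub>R (A *v x)) \<subseteq> {(c *\<^sub>R A) *v (d *\<^sub>R x) | c d. True}"
    proof
      fix z assume "z \<in> range (\<lambda>c. c *\<^sub>R (A *v x))"
      then obtain c where "z = (c *\<^sub>R A) *v (1 *\<^sub>R x)"
        by (auto simp: matrix_vector_scaleR_left)
      then show "z \<in> {(c *\<^sub>R A) *v (d *\<^sub>R x) | c d. True}"
        by blast
    qed
  qed
  finally show ?thesis
    by (simp add: span_singleton)
qed

lemma chartsD:
  assumes "(W, V, f) \<in> charts k T"
  shows "subspace W" "dim W = k" "openin (top_of_set W) V" "V \<subseteq> W" "continuous_on V f"
    and "\<And>x. x \<in> V \<Longrightarrow> f x \<noteq> 0"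
    and "\<And>x. x \<in> V \<Longrightarrow> \<exists>f'. (f has_derivative f') (at x within V) \<and> (\<forall>w\<in>W. f' w \<in> span {f x} \<longrightarrow> w = 0)"
    and "openin T ((\<lambda>x. span {f x}) ` V)"
    and "homeomorphic_map (top_of_set V) (subtopology T ((\<lambda>x. span {f x}) ` V)) (\<lambda>x. span {f x})"
proof -
  show "subspace W" "dim W = k" "openin (top_of_set W) V"
    and "openin T ((\<lambda>x. span {f x}) ` V)"
    and "homeomorphic_map (top_of_set V) (subtopology T ((\<lambda>x. span {f x}) ` V)) (\<lambda>x. span {f x})"
    using assms by (auto simp: charts_def)
  then show "V \<subseteq> W"
    using openin_imp_subset by blast
  have imm: "proj_immersion W V f"
    using assms by (auto simp: charts_def)
  then have "C_on 0 W V f"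
    by (auto simp: proj_immersion_def smooth_on_def)
  then show "continuous_on V f"
    by simp
  show "f x \<noteq> 0" if "x \<in> V" for x
    using imm that by (auto simp: proj_immersion_def)
  show "\<exists>f'. (f has_derivative f') (at x within V) \<and> (\<forall>w\<in>W. f' w \<in> span {f x} \<longrightarrow> w = 0)" if "x \<in> V" for x
    using imm that by (auto simp: proj_immersion_def)
qed

lemma chart_lifts:
  assumes "(W, V, f) \<in> charts k T" "x \<in> V"
  shows "f x \<in> lifts (topspace T)"
  using chartsD(6,8)[OF assms(1)] assms(2) openin_subset[of T] unfolding lifts_def by blast

lemma immersed_manifold_chart:
  assumes "immersed_manifold k T" "p \<in> topspace T"
  obtains W V f x where "(W, V, f) \<in> charts k T" "x \<in> V" "p = span {f x}"
proof -
  have "\<exists>(W, V, f)\<in>charts k T. p \<in> (\<lambda>x. span {f x}) ` V"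
    using assms by (simp add: immersed_manifold_def)
  then obtain c where "c \<in> charts k T" "case c of (W, V, f) \<Rightarrow> p \<in> (\<lambda>x. span {f x}) ` V"
    by (rule bexE)
  then show thesis
    using that by (cases c) auto
qed

text \<open>A straight line in a chart exists on both sides of its starting point, so its image has an ordinary
  two-sided velocity although the derivative of the chart is only taken within \<open>V\<close>.\<close>

lemma line_in_chart:
  assumes W: "subspace W" and V: "openin (top_of_set W) V" and x: "x \<in> V" and w: "w \<in> W"
    and f': "(f has_derivative f') (at x within V)"
  obtains e where "0 < e" "\<And>s. \<bar>s\<bar> \<le> e \<Longrightarrow> x + s *\<^sub>R w \<in> V"
    "((\<lambda>s. f (x + s *\<^sub>R w)) has_vector_derivative f' w) (at 0)"
proof -
  obtain U where U: "open U" "V = W \<inter> U"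
    using V by (auto simp: openin_open)
  have "open ((\<lambda>s::real. x + s *\<^sub>R w) -` U)"
    using U(1) by (intro open_vimage continuous_intros)
  moreover have "0 \<in> (\<lambda>s::real. x + s *\<^sub>R w) -` U"
    using U x by simp
  ultimately obtain d where "0 < d" "ball 0 d \<subseteq> (\<lambda>s::real. x + s *\<^sub>R w) -` U"
    by (meson open_contains_ball)
  then have d: "0 < d" "\<And>s. \<bar>s\<bar> < d \<Longrightarrow> x + s *\<^sub>R w \<in> U"
    by (auto simp: subset_iff)
  define e where "e = d / 2"
  have "0 < e"
    using d by (simp add: e_def)
  have in_V: "x + s *\<^sub>R w \<in> V" if "\<bar>s\<bar> \<le> e" for s
    using d that x w U W by (auto simp: e_def intro!: subspace_add subspace_scale)
  have line: "((\<lambda>s. x + s *\<^sub>R w) has_vector_derivative w) (at 0 within {-e..e})"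
    by (auto intro!: derivative_eq_intros)
  have "(f has_derivative f') (at (x + 0 *\<^sub>R w) within (\<lambda>s. x + s *\<^sub>R w) ` {-e..e})"
    using f' in_V by (auto intro!: has_derivative_subset[where s = V])
  from vector_derivative_diff_chain_within[OF line this]
  have "((\<lambda>s. f (x + s *\<^sub>R w)) has_vector_derivative f' w) (at 0 within {-e..e})"
    by (simp add: o_def)
  then have "((\<lambda>s. f (x + s *\<^sub>R w)) has_vector_derivative f' w) (at 0)"
    using \<open>0 < e\<close> by (simp add: at_within_Icc_at)
  with \<open>0 < e\<close> in_V show thesis
    using that by blast
qed

text \<open>If \<open>y\<close> is orthogonal to \<open>u 0\<close>, the squared cosine of the angle between \<open>y\<close> and \<open>u s\<close> has zero derivative,
  since numerator and denominator both grow at the rate \<open>2 l\<close>. Hence \<open>u 1\<close> stays orthogonal to all such \<open>y\<close>.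
  This replaces the integrating factor of the equation, for which \<open>l\<close> would have to be integrable.\<close>

lemma radial_curve_in_line:
  fixes u :: "real \<Rightarrow> 'a::euclidean_space"
  assumes "\<And>s. s \<in> {0..1} \<Longrightarrow> (u has_vector_derivative l s *\<^sub>R u s) (at s within {0..1})"
    and "\<And>s. s \<in> {0..1} \<Longrightarrow> u s \<noteq> 0"
  shows "u 1 \<in> span {u 0}"
proof -
  have orth: "u 1 \<bullet> y = 0" if "u 0 \<bullet> y = 0" for y
  proof -
    define q where "q s = (u s \<bullet> y)\<^sup>2 / (u s \<bullet> u s)" for s
    have "(q has_field_derivative 0) (at s within {0..1})" if s: "s \<in> {0..1}" for s
    proof -
      have 1: "((\<lambda>s. u s \<bullet> y) has_real_derivative l s * (u s \<bullet> y)) (at s within {0..1})"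
        using bounded_linear.has_vector_derivative[OF bounded_linear_inner_left assms(1)[OF s], of y]
        by (simp add: has_real_derivative_iff_has_vector_derivative)
      have 2: "((\<lambda>s. u s \<bullet> u s) has_real_derivative 2 * (l s * (u s \<bullet> u s))) (at s within {0..1})"
        using bounded_bilinear.has_vector_derivative[OF bounded_bilinear_inner assms(1)[OF s] assms(1)[OF s]]
        by (simp add: has_real_derivative_iff_has_vector_derivative)
      have "u s \<bullet> u s \<noteq> 0"
        using assms(2)[OF s] by simp
      from DERIV_divide[OF DERIV_power[OF 1, of 2] 2 this] this show ?thesis
        unfolding q_def by (simp add: power2_eq_square algebra_simps)
    qed
    then have "\<exists>c. \<forall>s\<in>{0..1}. q s = c"
      by (intro has_field_derivative_zero_constant) auto
    then have "q 1 = q 0"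
      by fastforce
    then show ?thesis
      using that assms(2)[of 1] by (simp add: q_def)
  qed
  define c where "c = (u 1 \<bullet> u 0) / (u 0 \<bullet> u 0)"
  define y where "y = u 1 - c *\<^sub>R u 0"
  have y0: "u 0 \<bullet> y = 0"
    using assms(2)[of 0] by (simp add: y_def c_def inner_diff_right inner_commute)
  then have "y \<bullet> y = 0"
    using orth[OF y0] by (simp add: y_def inner_diff_left)
  then have "u 1 = c *\<^sub>R u 0"
    by (simp add: y_def)
  then show ?thesis
    by (simp add: span_base span_scale)
qed

lemma constant_on_connected_space:
  assumes "connected_space T"
    and local: "\<And>g. g \<in> topspace T \<Longrightarrow> \<exists>U. openin T U \<and> g \<in> U \<and> (\<forall>h\<in>U. F h = F g)"
    and "a \<in> topspace T" "b \<in> topspace T"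
  shows "F a = F b"
proof (rule ccontr)
  assume neq: "F a \<noteq> F b"
  define S1 where "S1 = {g \<in> topspace T. F g = F a}"
  define S2 where "S2 = {g \<in> topspace T. F g \<noteq> F a}"
  have "openin T S" if S: "S = {g \<in> topspace T. F g \<in> Y}" for S Y
    unfolding openin_subopen[of T S]
  proof
    fix g assume "g \<in> S"
    then have "g \<in> topspace T"
      using S by simp
    from local[OF this] obtain U where U: "openin T U" "g \<in> U" "\<forall>h\<in>U. F h = F g"
      by (elim exE conjE)
    have "U \<subseteq> S"
    proof
      fix h assume "h \<in> U"
      moreover from this have "F h = F g"
        using U(3) by (rule bspec[rotated])
      ultimately show "h \<in> S"
        using \<open>g \<in> S\<close> openin_subset[OF U(1)] unfolding S by auto
    qed
    with U show "\<exists>U. openin T U \<and> g \<in> U \<and> U \<subseteq> S"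
      by blast
  qed
  from this[of S1 "{F a}"] this[of S2 "- {F a}"] have "openin T S1" "openin T S2"
    by (simp_all add: S1_def S2_def)
  moreover have "topspace T \<subseteq> S1 \<union> S2" "S1 \<inter> S2 = {}" "a \<in> S1" "b \<in> S2"
    using assms neq by (auto simp: S1_def S2_def)
  ultimately show False
    using assms(1) unfolding connected_space_def by blast
qed

context linear_group
begin

lemma apply_nonzero:
  assumes "A \<in> \<Gamma>" "v \<noteq> 0"
  shows "A *v v \<noteq> 0"
proof
  assume "A *v v = 0"
  moreover obtain B where "B ** A = mat 1"
    using inverse[OF assms(1)] by blast
  ultimately show False
    using assms(2) by (metis matrix_vector_mul_assoc matrix_vector_mul_lid matrix_vector_mult_0_right)
qed

text \<open>Left translation by the inverse of \<open>f x\<close> moves the curve \<open>s \<mapsto> f (x + s w)\<close> to the identity.\<close>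

lemma chart_logarithmic_derivative:
  assumes chart: "(W, V, f) \<in> charts k T" and lifts: "lifts (topspace T) \<subseteq> \<Gamma>"
    and x: "x \<in> V" and w: "w \<in> W"
  obtains X where "X \<in> tangent" "((\<lambda>s. f (x + s *\<^sub>R w)) has_vector_derivative f x ** X) (at 0)"
proof -
  note ch = chartsD[OF chart]
  obtain f' where f': "(f has_derivative f') (at x within V)"
    using ch(7)[OF x] by blast
  obtain e where e: "0 < e" "\<And>s. \<bar>s\<bar> \<le> e \<Longrightarrow> x + s *\<^sub>R w \<in> V"
    "((\<lambda>s. f (x + s *\<^sub>R w)) has_vector_derivative f' w) (at 0)"
    using line_in_chart[OF ch(1,3) x w f'] by blast
  have in_\<Gamma>: "f y \<in> \<Gamma>" if "y \<in> V" for y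
    using chart_lifts[OF chart that] lifts by blast
  obtain B where B: "B \<in> \<Gamma>" "f x ** B = mat 1" "B ** f x = mat 1"
    using inverse[OF in_\<Gamma>[OF x]] by blast
  note lin = bounded_bilinear.bounded_linear_right[OF bounded_bilinear_matrix_mult, of B]
  have "B ** f' w \<in> tangent"
  proof (rule tangent_of_local_curve[OF e(1)])
    show "continuous_on {-e..e} (\<lambda>s. B ** f (x + s *\<^sub>R w))"
    proof (rule bounded_linear.continuous_on[OF lin])
      show "continuous_on {-e..e} (\<lambda>s. f (x + s *\<^sub>R w))"
        by (rule continuous_on_compose2[OF ch(5)]) (auto intro!: continuous_intros e(2))
    qed
    show "B ** f (x + t *\<^sub>R w) \<in> \<Gamma>" if "t \<in> {-e..e}" for t
      using that by (intro mult B(1) in_\<Gamma> e(2)) auto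
    show "B ** f (x + 0 *\<^sub>R w) = mat 1"
      using B by simp
    show "((\<lambda>s. B ** f (x + s *\<^sub>R w)) has_vector_derivative B ** f' w) (at 0)"
      by (rule bounded_linear.has_vector_derivative[OF lin e(3)])
  qed
  moreover have "f x ** (B ** f' w) = f' w"
    using B by (simp add: matrix_mul_assoc)
  ultimately show thesis
    using that e(3) by metis
qed

text \<open>Along a segment in a chart the vector \<open>u s = f (x + s w) v\<close> satisfies \<open>u' = l u\<close>, because the logarithmic
  derivative of \<open>f\<close> scales \<open>v\<close>.\<close>

lemma invariant_line_locally:
  assumes chart: "(W, V, f) \<in> charts k T" and lifts: "lifts (topspace T) \<subseteq> \<Gamma>"
    and v: "v \<noteq> 0" "\<And>X. X \<in> tangent \<Longrightarrow> X *v v \<in> span {v}"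
    and segment: "\<And>s. s \<in> {0..1} \<Longrightarrow> x + s *\<^sub>R w \<in> V" and w: "w \<in> W"
  shows "span {f (x + w) *v v} = span {f x *v v}"
proof -
  define u where "u s = f (x + s *\<^sub>R w) *v v" for s
  have in_\<Gamma>: "f y \<in> \<Gamma>" if "y \<in> V" for y
    using chart_lifts[OF chart that] lifts by blast
  have nz: "u s \<noteq> 0" if "s \<in> {0..1}" for s
    unfolding u_def using in_\<Gamma>[OF segment[OF that]] v(1) by (rule apply_nonzero)
  have "\<exists>l. (u has_vector_derivative l *\<^sub>R u s) (at s within {0..1})" if s: "s \<in> {0..1}" for s
  proof -
    obtain X where X: "X \<in> tangent"
      and "((\<lambda>r. f (x + s *\<^sub>R w + r *\<^sub>R w)) has_vector_derivative f (x + s *\<^sub>R w) ** X) (at 0)"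
      using chart_logarithmic_derivative[OF chart lifts segment[OF s] w] by blast
    then have deriv: "((\<lambda>r. u (s + r)) has_vector_derivative (f (x + s *\<^sub>R w) ** X) *v v) (at 0)"
      using bounded_linear.has_vector_derivative[OF bounded_bilinear.bounded_linear_left[OF bounded_bilinear_matrix_vector_mult], of _ _ _ v]
      by (simp add: u_def scaleR_add_left add.assoc)
    obtain l where l: "X *v v = l *\<^sub>R v"
      using v(2)[OF X] by (auto simp: span_singleton)
    have shift: "((\<lambda>r. r - s) has_vector_derivative 1) (at s)"
      by (auto intro!: derivative_eq_intros)
    have "((\<lambda>r. u (s + r)) \<circ> (\<lambda>r. r - s) has_vector_derivative 1 *\<^sub>R ((f (x + s *\<^sub>R w) ** X) *v v)) (at s)"
      using deriv by (intro vector_diff_chain_at[OF shift]) simp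
    then have "(u has_vector_derivative l *\<^sub>R u s) (at s)"
      by (simp add: o_def u_def[abs_def] l matrix_vector_mul_assoc[symmetric] matrix_vector_scaleR_right)
    then show ?thesis
      using has_vector_derivative_at_within by blast
  qed
  then obtain l where "\<And>s. s \<in> {0..1} \<Longrightarrow> (u has_vector_derivative l s *\<^sub>R u s) (at s within {0..1})"
    by metis
  then have "u 1 \<in> span {u 0}"
    using nz by (rule radial_curve_in_line)
  then have "span {u 1} = span {u 0}"
    using nz[of 1] by (intro span_singleton_cong) auto
  then show ?thesis
    by (simp add: u_def)
qed

end

text \<open>An infinitesimally invariant line is invariant: the map \<open>g \<mapsto> g [v]\<close> is locally constant in the topology
  of the Lie group, which is connected.\<close>

lemma invariant_line:
  fixes \<Gamma> :: "(real^5^5) set"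
  assumes "linear_group \<Gamma>"
    and T: "immersed_manifold k T" "connected_space T" and \<Gamma>: "\<Gamma> = lifts (topspace T)"
    and v: "v \<noteq> 0" "\<And>X. X \<in> linear_group.tangent \<Gamma> \<Longrightarrow> X *v v \<in> span {v}" and "A \<in> \<Gamma>"
  shows "span {A *v v} = span {v}"
proof -
  interpret linear_group \<Gamma> by fact
  have "act (span {A}) (span {v}) = act (span {mat 1}) (span {v})"
  proof (rule constant_on_connected_space[OF T(2), where F = "\<lambda>g. act g (span {v})"])
    show "span {A} \<in> topspace T" "span {mat 1} \<in> topspace T"
      using \<open>A \<in> \<Gamma>\<close> one \<Gamma> by (auto simp: lifts_def)
  next
    fix g assume "g \<in> topspace T"
    with T(1) obtain W V f x where chart: "(W, V, f) \<in> charts k T" and x: "x \<in> V" "g = span {f x}"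
      by (rule immersed_manifold_chart)
    note ch = chartsD[OF chart]
    obtain r where r: "0 < r" "ball x r \<inter> W \<subseteq> V"
      using ch(3) x(1) by (metis openin_contains_ball)
    define U where "U = (\<lambda>x. span {f x}) ` (V \<inter> ball x r)"
    have "openin (top_of_set V) (V \<inter> ball x r)"
      by (intro openin_open_Int) simp
    then have "openin (subtopology T ((\<lambda>x. span {f x}) ` V)) U"
      unfolding U_def using homeomorphic_imp_open_map[OF ch(9)] unfolding open_map_def by blast
    then have "openin T U"
      using ch(8) by (rule openin_trans_full)
    moreover have "g \<in> U"
      using x r by (auto simp: U_def)
    moreover have "act h (span {v}) = act g (span {v})" if "h \<in> U" for h
    proof -
      obtain y where y: "y \<in> V" "y \<in> ball x r" "h = span {f y}"
        using \<open>h \<in> U\<close> by (auto simp: U_def)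
      have "span {f (x + (y - x)) *v v} = span {f x *v v}"
      proof (rule invariant_line_locally[OF chart _ v])
        show "lifts (topspace T) \<subseteq> \<Gamma>"
          using \<Gamma> by simp
        show "y - x \<in> W"
          using x y ch(1,4) by (intro subspace_diff) auto
        show "x + s *\<^sub>R (y - x) \<in> V" if "s \<in> {0..1}" for s
        proof -
          have "x + s *\<^sub>R (y - x) \<in> ball x r"
          proof -
            have "x + s *\<^sub>R (y - x) = (1 - s) *\<^sub>R x + s *\<^sub>R y"
              by (simp add: algebra_simps)
            also have "\<dots> \<in> ball x r"
              using that y(2) r(1) by (intro convexD_alt[OF convex_ball]) auto
            finally show ?thesis .
          qed
          moreover have "x + s *\<^sub>R (y - x) \<in> W"
            using x y ch(1,4) by (intro subspace_add subspace_scale subspace_diff) auto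
          ultimately show ?thesis
            using r(2) by blast
        qed
      qed
      then show ?thesis
        by (simp add: x y act_span)
    qed
    ultimately show "\<exists>U. openin T U \<and> g \<in> U \<and> (\<forall>h\<in>U. act h (span {v}) = act g (span {v}))"
      by blast
  qed
  then show ?thesis
    by (simp add: act_span)
qed


section \<open>The size of orbits\<close>

text \<open>The set is the image of a differentiable map from a space of dimension \<open>4\<close>: two chart coordinates
  and the parameters \<open>t\<close> and \<open>r\<close>. A cone of null vectors is always negligible in \<open>\<real>\<^sup>5\<close>; only after
  the multiples of \<open>e\<close> are added does its size reflect the dimension of its base.\<close>

lemma negligible_cone_over_chart:
  fixes e :: "real^5"
  assumes chart: "(W, V, f) \<in> charts 2 T"
  shows "negligible {t *\<^sub>R f x + r *\<^sub>R e | t x r. x \<in> V}"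
proof -
  note ch = chartsD[OF chart]
  obtain L :: "real^2 \<Rightarrow> real^5" where L: "linear L" "range L = W"
    by (rule isometries_subspaces[of "UNIV :: (real^2) set" W]) (use ch(1,2) in auto)
  define S :: "((real \<times> real) \<times> (real^2)) set" where "S = UNIV \<times> (L -` V)"
  define F where "F z = fst (fst z) *\<^sub>R f (L (snd z)) + snd (fst z) *\<^sub>R e" for z
  have "F differentiable_on S"
    unfolding differentiable_on_def
  proof
    fix z assume z: "z \<in> S"
    then have "L (snd z) \<in> V"
      by (auto simp: S_def)
    then obtain f' where f': "(f has_derivative f') (at (L (snd z)) within V)"
      using ch(7) by blast
    have "((\<lambda>z. L (snd z)) has_derivative (\<lambda>z. L (snd z))) (at z within S)"
      using linear_linear L(1) by (intro bounded_linear_imp_has_derivative bounded_linear_compose[of L snd])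
        (auto simp: linear_conv_bounded_linear bounded_linear_snd)
    moreover have "(f has_derivative f') (at (L (snd z)) within (\<lambda>z. L (snd z)) ` S)"
      using f' by (rule has_derivative_subset) (auto simp: S_def)
    ultimately have "((\<lambda>z. f (L (snd z))) has_derivative (\<lambda>z. f' (L (snd z)))) (at z within S)"
      by (rule has_derivative_in_compose)
    then have "(\<lambda>z. f (L (snd z))) differentiable (at z within S)"
      by (rule differentiableI)
    then show "F differentiable (at z within S)"
      unfolding F_def
      by (rule differentiable_add[OF differentiable_scaleR[OF
            bounded_linear_imp_differentiable[OF bounded_linear_compose[OF bounded_linear_fst bounded_linear_fst]]]
          differentiable_scaleR[OF
            bounded_linear_imp_differentiable[OF bounded_linear_compose[OF bounded_linear_snd bounded_linear_fst]]
            differentiable_const]])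
  qed
  then have "negligible (F ` S)"
    by (intro negligible_differentiable_image_lowdim) simp_all
  moreover have "{t *\<^sub>R f x + r *\<^sub>R e | t x r. x \<in> V} \<subseteq> F ` S"
  proof clarify
    fix t x r assume "x \<in> V"
    then obtain y where "x = L y"
      using L(2) ch(4) by blast
    with \<open>x \<in> V\<close> show "t *\<^sub>R f x + r *\<^sub>R e \<in> F ` S"
      by (intro image_eqI[of _ _ "((t, r), y)"]) (auto simp: F_def S_def)
  qed
  ultimately show ?thesis
    by (rule negligible_subset)
qed

text \<open>Second countability lets countably many charts cover the surface: one for each basic open set that
  is contained in the coordinate patch of some chart.\<close>

lemma negligible_cone_over_surface:
  fixes e :: "real^5"
  assumes "immersed_submanifold 2 S"
  shows "negligible {y + r *\<^sub>R e | y r. y \<in> lifts S}"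
proof -
  obtain T where T: "topspace T = S" "immersed_manifold 2 T"
    using assms by (auto simp: immersed_submanifold_def)
  obtain \<B> where \<B>: "countable \<B>" "\<And>U x. openin T U \<Longrightarrow> x \<in> U \<Longrightarrow> \<exists>B\<in>\<B>. x \<in> B \<and> B \<subseteq> U"
    using T(2) unfolding immersed_manifold_def second_countable_def by metis
  define cone where "cone c = {t *\<^sub>R snd (snd c) x + r *\<^sub>R e | t x r. x \<in> fst (snd c)}"
    for c :: "(real^5) set \<times> (real^5) set \<times> (real^5 \<Rightarrow> real^5)"
  define covers where "covers B c \<longleftrightarrow> c \<in> charts 2 T \<and> B \<subseteq> (\<lambda>x. span {snd (snd c) x}) ` fst (snd c)" for B c
  define chart where "chart B = (SOME c. covers B c)" for B
  have chart: "covers B (chart B)" if "covers B c" for B c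
    unfolding chart_def using that by (rule someI)
  have "negligible (\<Union>B\<in>{B\<in>\<B>. covers B (chart B)}. cone (chart B))"
  proof (rule negligible_countable_Union)
    show "countable ((\<lambda>B. cone (chart B)) ` {B \<in> \<B>. covers B (chart B)})"
      using \<B>(1) by (intro countable_image countable_subset[OF _ \<B>(1)]) auto
    fix N assume "N \<in> (\<lambda>B. cone (chart B)) ` {B \<in> \<B>. covers B (chart B)}"
    then obtain B where "covers B (chart B)" "N = cone (chart B)"
      by blast
    then show "negligible N"
      using negligible_cone_over_chart[of "fst (chart B)" "fst (snd (chart B))" "snd (snd (chart B))" T e]
      by (simp add: cone_def covers_def)
  qed
  moreover have "{y + r *\<^sub>R e | y r. y \<in> lifts S} \<subseteq> (\<Union>B\<in>{B\<in>\<B>. covers B (chart B)}. cone (chart B))"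
  proof clarify
    fix y r assume "y \<in> lifts S"
    then have "span {y} \<in> topspace T"
      using T(1) by (simp add: lifts_def)
    then obtain W V f x where ch: "(W, V, f) \<in> charts 2 T" "x \<in> V" "span {y} = span {f x}"
      by (rule immersed_manifold_chart[OF T(2)])
    then obtain B where B: "B \<in> \<B>" "span {y} \<in> B" "B \<subseteq> (\<lambda>x. span {f x}) ` V"
      using \<B>(2)[OF chartsD(8)[OF ch(1)], of "span {y}"] by blast
    then have cov: "covers B (chart B)"
      using ch(1) by (intro chart[of B "(W, V, f)"]) (simp add: covers_def)
    then obtain z where z: "z \<in> fst (snd (chart B))" "span {y} = span {snd (snd (chart B)) z}"
      using B(2) unfolding covers_def by blast
    have "y \<in> span {snd (snd (chart B)) z}"
      using z(2) span_base[of y "{y}"] by simp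
    then obtain t where "y = t *\<^sub>R snd (snd (chart B)) z"
      by (auto simp: span_singleton)
    then have "y + r *\<^sub>R e \<in> cone (chart B)"
      using z(1) unfolding cone_def by blast
    then show "y + r *\<^sub>R e \<in> (\<Union>B\<in>{B\<in>\<B>. covers B (chart B)}. cone (chart B))"
      using B(1) cov by blast
  qed
  ultimately show ?thesis
    by (rule negligible_subset)
qed

text \<open>At a point of a chart \<open>f\<close>, the vector \<open>f x\<close> and the two-dimensional image of the derivative would be
  independent in \<open>P\<close>.\<close>

lemma no_surface_in_projective_line:
  fixes P :: "'a::euclidean_space set"
  assumes "immersed_submanifold 2 S" "S \<subseteq> proj P" "S \<noteq> {}" and P: "subspace P" "dim P = 2"
  shows False
proof -
  obtain T where T: "topspace T = S" "immersed_manifold 2 T"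
    using assms by (auto simp: immersed_submanifold_def)
  then obtain p where "p \<in> topspace T"
    using assms(3) by blast
  then obtain W V f x where chart: "(W, V, f) \<in> charts 2 T" and x: "x \<in> V"
    by (rule immersed_manifold_chart[OF T(2)])
  note ch = chartsD[OF chart]
  have in_P: "f y \<in> P" if "y \<in> V" for y
  proof -
    have "span {f y} \<in> proj P"
      using chart_lifts[OF chart that] T(1) assms(2) by (auto simp: lifts_def)
    then obtain v where "v \<in> P" "span {f y} = span {v}"
      by (auto simp: proj_def)
    then show ?thesis
      using P(1) span_minimal[of "{v}" P] span_base[of "f y" "{f y}"] by auto
  qed
  obtain f' where f': "(f has_derivative f') (at x within V)"
    and immersive: "\<And>w. w \<in> W \<Longrightarrow> f' w \<in> span {f x} \<Longrightarrow> w = 0"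
    using ch(7)[OF x] by blast
  have lin: "linear f'"
    using f' by (rule has_derivative_linear)
  have "f' w \<in> P" if w: "w \<in> W" for w
  proof -
    obtain e where e: "0 < e" "\<And>s. \<bar>s\<bar> \<le> e \<Longrightarrow> x + s *\<^sub>R w \<in> V"
      "((\<lambda>s. f (x + s *\<^sub>R w)) has_vector_derivative f' w) (at 0)"
      using line_in_chart[OF ch(1,3) x w f'] by blast
    show ?thesis
      by (rule vector_derivative_in_subspace[OF P(1) e(3,1)]) (auto intro!: in_P e(2))
  qed
  then have "f' ` W \<subseteq> P" by blast
  have "inj_on f' W"
  proof (rule inj_onI)
    fix u v assume "u \<in> W" "v \<in> W" "f' u = f' v"
    then have "u - v \<in> W" "f' (u - v) = 0"
      using ch(1) lin by (auto simp: subspace_diff linear_diff)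
    then have "u - v = 0"
      by (intro immersive) (simp_all add: span_zero)
    then show "u = v" by simp
  qed
  then have "dim (f' ` W) = dim W"
    using ch(1) by (intro dim_image_eq lin) (simp add: span_eq_iff[THEN iffD2])
  then have "f' ` W = P"
    using \<open>f' ` W \<subseteq> P\<close> ch(1,2) P lin by (intro subspace_dim_equal linear_subspace_image) auto
  then obtain w where "w \<in> W" "f' w = f x"
    using in_P[OF x] by (metis imageE)
  then have "w = 0"
    by (intro immersive) (simp_all add: span_base)
  then show False
    using \<open>f' w = f x\<close> ch(6)[OF x] linear_0[OF lin] by simp
qed

text \<open>The map \<open>(t1, t2, t3, t4, r) \<mapsto> \<gamma>1(t1) \<gamma>2(t2) \<gamma>3(t3) exp(t4) p + r e\<close> with curves \<open>\<gamma>i\<close> of velocity \<open>Xi\<close> has surjective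
  derivative at \<open>0\<close>, so its image contains an open set. Differentiability at the single point \<open>0\<close>
  suffices for this, given continuity.\<close>

lemma orbit_not_negligible:
  fixes \<Gamma> :: "(real^5^5) set"
  assumes "linear_group \<Gamma>"
    and X: "X1 \<in> linear_group.tangent \<Gamma>" "X2 \<in> linear_group.tangent \<Gamma>" "X3 \<in> linear_group.tangent \<Gamma>"
    and onto: "\<And>w. \<exists>t1 t2 t3 t4 r. w = t1 *\<^sub>R (X1 *v p) + t2 *\<^sub>R (X2 *v p) + t3 *\<^sub>R (X3 *v p) + t4 *\<^sub>R p + r *\<^sub>R e"
  shows "\<not> negligible {A *v p + r *\<^sub>R e | A r. A \<in> \<Gamma>}"
proof
  assume neg: "negligible {A *v p + r *\<^sub>R e | A r. A \<in> \<Gamma>}"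
  interpret linear_group \<Gamma> by fact
  obtain \<gamma>1 :: "real \<Rightarrow> real^5^5" where \<gamma>1: "continuous_on UNIV \<gamma>1" "\<And>t. \<gamma>1 t \<in> \<Gamma>" "\<gamma>1 0 = mat 1"
      "(\<gamma>1 has_vector_derivative X1) (at 0)"
    using X(1) by (metis tangentE)
  obtain \<gamma>2 :: "real \<Rightarrow> real^5^5" where \<gamma>2: "continuous_on UNIV \<gamma>2" "\<And>t. \<gamma>2 t \<in> \<Gamma>" "\<gamma>2 0 = mat 1"
      "(\<gamma>2 has_vector_derivative X2) (at 0)"
    using X(2) by (metis tangentE)
  obtain \<gamma>3 :: "real \<Rightarrow> real^5^5" where \<gamma>3: "continuous_on UNIV \<gamma>3" "\<And>t. \<gamma>3 t \<in> \<Gamma>" "\<gamma>3 0 = mat 1"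
      "(\<gamma>3 has_vector_derivative X3) (at 0)"
    using X(3) by (metis tangentE)
  define F :: "real \<times> real \<times> real \<times> real \<times> real \<Rightarrow> real^5"
    where "F z = \<gamma>1 (fst z) *v (\<gamma>2 (fst (snd z)) *v (\<gamma>3 (fst (snd (snd z))) *v
      (exp (fst (snd (snd (snd z)))) *\<^sub>R p))) + snd (snd (snd (snd z))) *\<^sub>R e" for z
  define F' where "F' z = fst z *\<^sub>R (X1 *v p) + fst (snd z) *\<^sub>R (X2 *v p) + fst (snd (snd z)) *\<^sub>R (X3 *v p)
      + fst (snd (snd (snd z))) *\<^sub>R p + snd (snd (snd (snd z))) *\<^sub>R e"
    for z :: "real \<times> real \<times> real \<times> real \<times> real"
  note continuous = continuous_on_compose2[OF _ _ subset_UNIV]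
    bounded_bilinear.continuous_on[OF bounded_bilinear_matrix_vector_mult]
  have "continuous_on UNIV F"
    unfolding F_def
    by (intro continuous_on_add continuous_on_scaleR continuous_intros continuous_on_const
        bounded_bilinear.continuous_on[OF bounded_bilinear_matrix_vector_mult]
        continuous_on_compose2[OF \<gamma>1(1)] continuous_on_compose2[OF \<gamma>2(1)] continuous_on_compose2[OF \<gamma>3(1)]) auto
  have along: "((\<lambda>z. \<gamma> (g z)) has_derivative (\<lambda>z. g z *\<^sub>R X)) (at 0)"
    if "(\<gamma> has_vector_derivative X) (at 0)" "bounded_linear g"
    for \<gamma> X and g :: "real \<times> real \<times> real \<times> real \<times> real \<Rightarrow> real"
  proof -
    have "g 0 = 0"
      using that(2) by (simp add: linear_simps)
    then show ?thesis
      using that by (intro has_derivative_compose[OF bounded_linear_imp_has_derivative[OF that(2)]])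
        (simp add: has_vector_derivative_def)
  qed
  have exp: "((\<lambda>t::real. exp t *\<^sub>R p) has_vector_derivative p) (at 0)"
    by (auto intro!: derivative_eq_intros)
  note lin = bounded_linear_fst bounded_linear_snd bounded_linear_compose[OF bounded_linear_fst]
     bounded_linear_compose[OF bounded_linear_snd]
  note product_rule = bounded_bilinear.FDERIV[OF bounded_bilinear_matrix_vector_mult]
  have "((\<lambda>z. snd (snd (snd (snd z))) *\<^sub>R e) has_derivative (\<lambda>z. snd (snd (snd (snd z))) *\<^sub>R e))
      (at (0 :: real \<times> real \<times> real \<times> real \<times> real))"
    by (intro bounded_linear_imp_has_derivative bounded_linear_compose[OF bounded_linear_scaleR_left] lin)
  from has_derivative_add[OF product_rule[OF along[OF \<gamma>1(4), of fst] product_rule[OF along[OF \<gamma>2(4), of "\<lambda>z. fst (snd z)"]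
      product_rule[OF along[OF \<gamma>3(4), of "\<lambda>z. fst (snd (snd z))"] along[OF exp, of "\<lambda>z. fst (snd (snd (snd z)))"]]]] this]
  have deriv: "(F has_derivative F') (at 0)"
    by (simp add: F_def[abs_def] F'_def[abs_def] \<gamma>1(3) \<gamma>2(3) \<gamma>3(3) lin matrix_vector_scaleR_left
        matrix_vector_scaleR_right algebra_simps)
  have "surj F'"
    unfolding surj_def
  proof
    fix w
    obtain t1 t2 t3 t4 r where "w = t1 *\<^sub>R (X1 *v p) + t2 *\<^sub>R (X2 *v p) + t3 *\<^sub>R (X3 *v p) + t4 *\<^sub>R p + r *\<^sub>R e"
      using onto by blast
    then have "w = F' (t1, t2, t3, t4, r)"
      by (simp add: F'_def)
    then show "\<exists>z. w = F' z" ..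
  qed
  moreover have "linear F'"
    using deriv by (rule has_derivative_linear)
  ultimately obtain g where g: "linear g" "F' \<circ> g = id"
    using linear_surjective_right_inverse by blast
  have "F 0 \<in> interior (F ` UNIV)"
    by (rule sussmann_open_mapping[OF open_UNIV \<open>continuous_on UNIV F\<close> UNIV_I deriv _ g(2)])
      (use g(1) in \<open>auto simp: linear_conv_bounded_linear\<close>)
  then have "interior (range F) \<noteq> {}"
    by blast
  then have "\<not> negligible (interior (range F))"
    by (intro open_not_negligible) auto
  moreover have "range F \<subseteq> {A *v p + r *\<^sub>R e | A r. A \<in> \<Gamma>}"
  proof clarify
    fix t1 t2 t3 t4 r
    have "\<gamma>1 t1 ** (\<gamma>2 t2 ** (\<gamma>3 t3 ** (exp t4 *\<^sub>R mat 1))) \<in> \<Gamma>"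
      by (intro mult scale one \<gamma>1(2) \<gamma>2(2) \<gamma>3(2)) simp
    moreover have "F (t1, t2, t3, t4, r) = (\<gamma>1 t1 ** (\<gamma>2 t2 ** (\<gamma>3 t3 ** (exp t4 *\<^sub>R mat 1)))) *v p + r *\<^sub>R e"
      by (simp add: F_def matrix_vector_mul_assoc[symmetric] matrix_vector_scaleR_left)
    ultimately show "\<exists>A r'. F (t1, t2, t3, t4, r) = A *v p + r' *\<^sub>R e \<and> A \<in> \<Gamma>"
      by blast
  qed
  ultimately show False
    using neg interior_subset negligible_subset by (metis (no_types, lifting))
qed


section \<open>The conformal group of the Einstein universe\<close>

lemma O23_bil: "A \<in> O23 \<Longrightarrow> bil (A *v u) (A *v v) = bil u v"
  by (simp add: O23_def bil_polarization matrix_vector_right_distrib[symmetric])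

lemma lift_similarity:
  assumes "G \<subseteq> proj O23" "A \<in> lifts G"
  obtains \<kappa> where "\<kappa> \<noteq> 0" "\<And>u v. bil (A *v u) (A *v v) = \<kappa> * bil u v"
proof -
  obtain A0 where A0: "A0 \<in> O23" "span {A} = span {A0}"
    using assms by (auto simp: lifts_def proj_def)
  then have "A \<in> span {A0}"
    using span_base[of A "{A}"] by simp
  then obtain c where c: "A = c *\<^sub>R A0"
    by (auto simp: span_singleton)
  then have "c \<noteq> 0"
    using assms(2) by (auto simp: lifts_def)
  moreover have "bil (A *v u) (A *v v) = c\<^sup>2 * bil u v" for u v
    by (simp add: c matrix_vector_scaleR_left bil_simps O23_bil[OF A0(1)] power2_eq_square)
  ultimately show thesis
    using that[of "c\<^sup>2"] by simp
qed

lemma lift_invertible: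
  assumes "G \<subseteq> proj O23" "A \<in> lifts G"
  obtains B where "A ** B = mat 1" "B ** A = mat 1"
proof -
  obtain \<kappa> where \<kappa>: "\<kappa> \<noteq> 0" "\<And>u v. bil (A *v u) (A *v v) = \<kappa> * bil u v"
    using lift_similarity[OF assms] by blast
  have "x = 0" if "A *v x = 0" for x
    using \<kappa>(2)[of x] \<kappa>(1) that by (intro bil_nondegenerate) (simp add: bil_simps)
  then obtain B where "B ** A = mat 1"
    using matrix_left_invertible_ker[of A] by blast
  then show thesis
    using that matrix_left_right_inverse by blast
qed

lemma span_mult:
  fixes A B :: "real^5^5"
  shows "{C ** D | C D. C \<in> span {A} \<and> D \<in> span {B}} = span {A ** B}"
proof
  show "{C ** D | C D. C \<in> span {A} \<and> D \<in> span {B}} \<subseteq> span {A ** B}"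
    by (auto simp: span_singleton matrix_mult_scaleR_left matrix_mult_scaleR_right)
  show "span {A ** B} \<subseteq> {C ** D | C D. C \<in> span {A} \<and> D \<in> span {B}}"
  proof
    fix Z assume "Z \<in> span {A ** B}"
    then obtain c where "Z = (c *\<^sub>R A) ** B"
      by (auto simp: span_singleton matrix_mult_scaleR_left)
    then show "Z \<in> {C ** D | C D. C \<in> span {A} \<and> D \<in> span {B}}"
      using span_scale[OF span_base, of A "{A}" c] span_base[of B "{B}"] by blast
  qed
qed

lemma Conf_Ein_simps:
  "carrier Conf_Ein = proj O23" "\<one>\<^bsub>Conf_Ein\<^esub> = span {mat 1}"
  "span {A} \<otimes>\<^bsub>Conf_Ein\<^esub> span {B} = span {A ** B}"
  by (simp_all add: Conf_Ein_def span_mult)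

lemma factors_of_one_nonzero:
  fixes C D :: "real^5^5"
  assumes "C ** D = mat 1"
  shows "C \<noteq> 0" "D \<noteq> 0"
proof -
  have "(mat 1 :: real^5^5) $ 1 $ 1 \<noteq> 0"
    by (simp add: mat_def)
  then have "(mat 1 :: real^5^5) \<noteq> 0"
    by auto
  then show "C \<noteq> 0" "D \<noteq> 0"
    using assms bounded_bilinear.zero_left[OF bounded_bilinear_matrix_mult, of D]
      bounded_bilinear.zero_right[OF bounded_bilinear_matrix_mult, of C] by metis+
qed

text \<open>The inverse in \<open>Conf_Ein\<close> is by definition an element with a uniqueness property, so it has to be
  identified with the class of the inverse matrix.\<close>

lemma inv_Conf_Ein:
  assumes A: "span {A} \<in> proj O23" "A \<noteq> 0" and AB: "A ** B = mat 1" "B ** A = mat 1"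
  shows "inv\<^bsub>Conf_Ein\<^esub> (span {A}) = span {B}"
  unfolding m_inv_def
proof (rule the_equality)
  obtain A0 where A0: "A0 \<in> O23" "span {A} = span {A0}"
    using A by (auto simp: proj_def)
  then have "A \<in> span {A0}"
    using span_base[of A "{A}"] by simp
  then obtain c where c: "A = c *\<^sub>R A0"
    by (auto simp: span_singleton)
  have "A0 *v ((c *\<^sub>R B) *v v) = v" for v
  proof -
    have "A0 *v ((c *\<^sub>R B) *v v) = A *v (B *v v)"
      by (simp add: c matrix_vector_scaleR_left matrix_vector_scaleR_right)
    then show ?thesis
      by (simp add: matrix_vector_mul_assoc AB)
  qed
  then have "c *\<^sub>R B \<in> O23"
    using A0(1) unfolding O23_def by (smt (verit) mem_Collect_eq)
  moreover have "c *\<^sub>R B \<noteq> 0"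
    using AB by (intro factors_of_one_nonzero(2)[of A0]) (simp add: c matrix_mult_scaleR_left matrix_mult_scaleR_right)
  moreover have "span {c *\<^sub>R B} = span {B}"
    using \<open>c *\<^sub>R B \<noteq> 0\<close> by (intro span_singleton_cong) (auto simp: span_base span_scale)
  ultimately have "span {B} \<in> proj O23"
    unfolding proj_def by blast
  then show "span {B} \<in> carrier Conf_Ein \<and> span {A} \<otimes>\<^bsub>Conf_Ein\<^esub> span {B} = \<one>\<^bsub>Conf_Ein\<^esub> \<and>
      span {B} \<otimes>\<^bsub>Conf_Ein\<^esub> span {A} = \<one>\<^bsub>Conf_Ein\<^esub>"
    by (simp add: Conf_Ein_simps AB)
next
  fix y assume y: "y \<in> carrier Conf_Ein \<and> span {A} \<otimes>\<^bsub>Conf_Ein\<^esub> y = \<one>\<^bsub>Conf_Ein\<^esub> \<and>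
      y \<otimes>\<^bsub>Conf_Ein\<^esub> span {A} = \<one>\<^bsub>Conf_Ein\<^esub>"
  then obtain C where C: "y = span {C}" "C \<noteq> 0"
    by (auto simp: Conf_Ein_simps proj_def)
  then have "A ** C \<in> span {mat 1}"
    using y span_base[of "A ** C" "{A ** C}"] by (simp add: Conf_Ein_simps)
  then obtain k where k: "A ** C = k *\<^sub>R mat 1"
    by (auto simp: span_singleton)
  have "C = B ** (A ** C)"
    by (simp add: matrix_mul_assoc AB)
  also have "\<dots> = k *\<^sub>R B"
    by (simp add: k matrix_mult_scaleR_right)
  finally show "y = span {B}"
    using C by (simp add: span_singleton_cong span_base span_scale)
qed

lemma linear_group_lifts:
  assumes "subgroup G Conf_Ein"
  shows "linear_group (lifts G)"
proof
  interpret subgroup G Conf_Ein by fact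
  have G: "G \<subseteq> proj O23"
    using subset by (simp add: Conf_Ein_simps)
  show "mat 1 \<in> lifts G"
    using one_closed factors_of_one_nonzero(1)[of "mat 1" "mat 1"] by (simp add: lifts_def Conf_Ein_simps)
  show "A ** B \<in> lifts G" if AB: "A \<in> lifts G" "B \<in> lifts G" for A B
  proof -
    obtain A' B' where "A ** A' = mat 1" "B ** B' = mat 1"
      using lift_invertible[OF G] AB by metis
    then have "(A ** B) ** (B' ** A') = mat 1"
      by (metis matrix_mul_assoc matrix_mul_rid)
    then have "A ** B \<noteq> 0"
      by (rule factors_of_one_nonzero)
    moreover have "span {A ** B} \<in> G"
      using m_closed[of "span {A}" "span {B}"] AB by (simp add: lifts_def Conf_Ein_simps)
    ultimately show ?thesis
      by (simp add: lifts_def)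
  qed
  show "\<exists>B\<in>lifts G. A ** B = mat 1 \<and> B ** A = mat 1" if A: "A \<in> lifts G" for A
  proof -
    obtain B where B: "A ** B = mat 1" "B ** A = mat 1"
      using lift_invertible[OF G A] by blast
    have "inv\<^bsub>Conf_Ein\<^esub> (span {A}) = span {B}"
      using A G B by (intro inv_Conf_Ein) (auto simp: lifts_def)
    then have "span {B} \<in> G"
      using A m_inv_closed[of "span {A}"] by (simp add: lifts_def)
    then show ?thesis
      using B factors_of_one_nonzero(1)[OF B(2)] by (auto simp: lifts_def)
  qed
  show "c *\<^sub>R A \<in> lifts G" if "A \<in> lifts G" "c \<noteq> 0" for A c
    using that span_singleton_cong[of "c *\<^sub>R A" A] by (auto simp: lifts_def span_base span_scale)
qed

text \<open>Differentiate \<open>bil (\<gamma> u) (\<gamma> v) = \<kappa> bil u v\<close>; the unit vector \<open>e\<close> serves to express the factor \<open>\<kappa>\<close> along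
  the curve, which is thereby differentiable.\<close>

lemma tangent_similarity:
  assumes sim: "\<And>A. A \<in> \<Gamma> \<Longrightarrow> \<exists>\<kappa>. \<forall>u v. bil (A *v u) (A *v v) = \<kappa> * bil u v"
    and "linear_group \<Gamma>" "X \<in> linear_group.tangent \<Gamma>" and unit: "bil e e = 1"
  shows "\<exists>k. \<forall>u v. bil (X *v u) v + bil u (X *v v) = 2 * k * bil u v"
proof -
  interpret linear_group \<Gamma> by fact
  obtain \<gamma> :: "real \<Rightarrow> real^5^5" where \<gamma>: "\<And>t. \<gamma> t \<in> \<Gamma>" "\<gamma> 0 = mat 1" "(\<gamma> has_vector_derivative X) (at 0)"
    using assms(3) by (metis tangentE)
  have deriv: "((\<lambda>t. bil (\<gamma> t *v u) (\<gamma> t *v v)) has_vector_derivative bil u (X *v v) + bil (X *v u) v) (at 0)" for u v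
    using bounded_bilinear.has_vector_derivative[OF bounded_bilinear_bil
      bounded_linear.has_vector_derivative[OF bounded_bilinear.bounded_linear_left[OF bounded_bilinear_matrix_vector_mult] \<gamma>(3), of u]
      bounded_linear.has_vector_derivative[OF bounded_bilinear.bounded_linear_left[OF bounded_bilinear_matrix_vector_mult] \<gamma>(3), of v]]
    by (simp add: \<gamma>(2))
  have factor: "bil (\<gamma> t *v u) (\<gamma> t *v v) = bil (\<gamma> t *v e) (\<gamma> t *v e) * bil u v" for t u v
  proof -
    obtain \<kappa> where "\<And>u v. bil (\<gamma> t *v u) (\<gamma> t *v v) = \<kappa> * bil u v"
      using sim[OF \<gamma>(1)] by blast
    then show ?thesis
      by (simp add: unit)
  qed
  have "bil (X *v u) v + bil u (X *v v) = 2 * bil e (X *v e) * bil u v" for u v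
  proof -
    have "((\<lambda>t. bil (\<gamma> t *v e) (\<gamma> t *v e) * bil u v) has_vector_derivative (bil e (X *v e) + bil (X *v e) e) * bil u v) (at 0)"
      by (rule bounded_linear.has_vector_derivative[OF bounded_linear_mult_left deriv])
    then have "((\<lambda>t. bil (\<gamma> t *v u) (\<gamma> t *v v)) has_vector_derivative (bil e (X *v e) + bil (X *v e) e) * bil u v) (at 0)"
      by (simp only: factor[of _ u v])
    then have "bil u (X *v v) + bil (X *v u) v = (bil e (X *v e) + bil (X *v e) e) * bil u v"
      by (rule vector_derivative_unique_at[OF deriv])
    then show ?thesis
      by (simp add: bil_commute[of "X *v e" e])
  qed
  then show ?thesis by blast
qed

text \<open>A similarity that preserves the line of \<open>v\<close> preserves the null cone and the hyperplane orthogonal to \<open>v\<close>.\<close>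

lemma preserves_complement_of_fixed_perp:
  assumes "subgroup G Conf_Ein" and v: "v \<noteq> 0" and fixed: "\<And>A. A \<in> lifts G \<Longrightarrow> span {A *v v} = span {v}"
  shows "preserves G (Ein - proj (perp v))"
proof -
  interpret subgroup G Conf_Ein by fact
  interpret linear_group "lifts G" using assms(1) by (rule linear_group_lifts)
  have G: "G \<subseteq> proj O23"
    using subset by (simp add: Conf_Ein_simps)
  let ?U = "Ein - proj (perp v)"
  have lift: "\<exists>A\<in>lifts G. g = span {A}" if "g \<in> G" for g
    using that G by (fastforce simp: lifts_def proj_def)
  have U: "span {x} \<in> ?U \<longleftrightarrow> qf x = 0 \<and> bil v x \<noteq> 0" if "x \<noteq> 0" for x
  proof -
    have same_line: "\<exists>c. c \<noteq> 0 \<and> x = c *\<^sub>R y" if "span {x} = span {y}" for y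
    proof -
      have "x \<in> span {y}"
        using that span_base[of x "{x}"] by simp
      then show ?thesis
        using \<open>x \<noteq> 0\<close> by (auto simp: span_singleton)
    qed
    have "span {x} \<in> Ein \<longleftrightarrow> qf x = 0"
    proof
      assume "span {x} \<in> Ein"
      then obtain y where y: "qf y = 0" "span {x} = span {y}"
        by (auto simp: Ein_def proj_def)
      from y show "qf x = 0"
        using same_line[OF y(2)] by (auto simp: qf_eq_bil bil_simps)
    qed (use that in \<open>auto simp: Ein_def proj_def\<close>)
    moreover have "span {x} \<in> proj (perp v) \<longleftrightarrow> bil v x = 0"
    proof
      assume "span {x} \<in> proj (perp v)"
      then obtain y where y: "bil v y = 0" "span {x} = span {y}"
        by (auto simp: perp_def proj_def)
      from y show "bil v x = 0"
        using same_line[OF y(2)] by (auto simp: bil_simps)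
    qed (use that in \<open>auto simp: perp_def proj_def\<close>)
    ultimately show ?thesis by simp
  qed
  have into: "act (span {A}) p \<in> ?U" if A: "A \<in> lifts G" and p: "p \<in> ?U" for A p
  proof -
    obtain x where x: "x \<noteq> 0" "p = span {x}"
      using p by (auto simp: Ein_def proj_def)
    obtain \<kappa> where \<kappa>: "\<kappa> \<noteq> 0" "\<And>u v. bil (A *v u) (A *v v) = \<kappa> * bil u v"
      using lift_similarity[OF G A] by blast
    have "A *v v \<in> span {v}"
      using fixed[OF A] span_base[of "A *v v" "{A *v v}"] by simp
    then obtain c where "A *v v = c *\<^sub>R v"
      by (auto simp: span_singleton)
    then have "c * bil v (A *v x) = \<kappa> * bil v x"
      using \<kappa>(2)[of v x] by (simp add: bil_simps)
    then have "bil v (A *v x) \<noteq> 0"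
      using p U[OF x(1)] x(2) \<kappa>(1) by auto
    moreover have "qf (A *v x) = 0"
      using p U[OF x(1)] x(2) \<kappa>(2)[of x x] by (simp add: qf_eq_bil)
    ultimately show ?thesis
      using U[OF apply_nonzero[OF A x(1)]] x(2) by (simp add: act_span)
  qed
  show ?thesis
    unfolding preserves_def
  proof
    fix g assume "g \<in> G"
    then obtain A where A: "A \<in> lifts G" "g = span {A}"
      using lift by blast
    then obtain B where B: "B \<in> lifts G" "A ** B = mat 1"
      using inverse by blast
    show "act g ` ?U = ?U"
    proof
      show "act g ` ?U \<subseteq> ?U"
        using into A by blast
      show "?U \<subseteq> act g ` ?U"
      proof
        fix p assume p: "p \<in> ?U"
        then obtain x where x: "p = span {x}"
          by (auto simp: Ein_def proj_def)
        have "p = act g (act (span {B}) p)"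
          by (simp add: x A(2) act_span matrix_vector_mul_assoc B(2))
        then show "p \<in> act g ` ?U"
          using into[OF B(1) p] by blast
      qed
    qed
  qed
qed

theorem theorem5p1:
  fixes \<phi> :: "(real^5) set set" and G :: "(real^5^5) set set"
  assumes "photon \<phi>"
    and "connected_lie_subgroup G Conf_Ein"
    and "preserves G \<phi>"
    and "\<exists>p\<in>Ein. immersed_submanifold 2 (orbit G p)"
  shows "(\<exists>p\<in>RP4. \<forall>g\<in>G. act g p = p) \<and>
         (\<exists>U. preserves G U \<and>
              (minkowski_patch U \<or> de_sitter_component U \<or> anti_de_sitter_component U))"
proof -
  obtain P where P: "subspace P" "dim P = 2" "\<And>u v. u \<in> P \<Longrightarrow> v \<in> P \<Longrightarrow> bil u v = 0" and \<phi>: "\<phi> = proj P"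
    using assms(1) by (auto simp: photon_def)
  obtain e1 e2 e0 f1 f2 where "witt_basis e1 e2 e0 f1 f2" and span_P: "P = span {e1, e2}"
    using witt_basis_of_isotropic_plane[OF P] by blast
  interpret witt_basis e1 e2 e0 f1 f2 by fact
  obtain k T where G: "subgroup G Conf_Ein" and T: "topspace T = G" "immersed_manifold k T" "connected_space T"
    using assms(2) by (auto simp: connected_lie_subgroup_def)
  have G_sub: "G \<subseteq> proj O23"
    using subgroup.subset[OF G] by (simp add: Conf_Ein_simps)
  interpret linear_group "lifts G" using G by (rule linear_group_lifts)
  have lift: "\<exists>A\<in>lifts G. g = span {A}" if "g \<in> G" for g
    using that G_sub by (fastforce simp: lifts_def proj_def)
  have in_P: "x \<in> P" if "span {x} \<in> \<phi>" for x
  proof -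
    obtain y where "y \<in> P" "span {x} = span {y}"
      using \<open>span {x} \<in> \<phi>\<close> by (auto simp: \<phi> proj_def)
    then show ?thesis
      using P(1) span_minimal[of "{y}" P] span_base[of x "{x}"] by auto
  qed
  have stable: "A *v x \<in> P" if A: "A \<in> lifts G" and x: "x \<in> P" for A x
  proof (cases "x = 0")
    case True
    then show ?thesis
      using P(1) by (simp add: subspace_0)
  next
    case False
    then have "span {x} \<in> \<phi>"
      using x by (auto simp: \<phi> proj_def)
    then have "act (span {A}) (span {x}) \<in> \<phi>"
      using A assms(3) by (auto simp: preserves_def lifts_def)
    then show ?thesis
      by (intro in_P) (simp add: act_span)
  qed
  obtain p where p: "p \<in> Ein" "immersed_submanifold 2 (orbit G p)"
    using assms(4) by blast
  then obtain y where y: "qf y = 0" "y \<noteq> 0" "p = span {y}"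
    by (auto simp: Ein_def proj_def)
  have orbit: "A *v y \<in> lifts (orbit G p)" if "A \<in> lifts G" for A
    using that apply_nonzero[OF that y(2)] unfolding lifts_def orbit_def y(3)
    by (auto simp: act_span intro!: image_eqI[of _ _ "span {A}"])
  \<comment> \<open>A point on the photon would have its orbit inside the photon, which is a projective line.\<close>
  have "y \<notin> P"
  proof
    assume "y \<in> P"
    then have "p \<in> \<phi>"
      using y by (auto simp: \<phi> proj_def)
    then have "orbit G p \<subseteq> \<phi>"
      using assms(3) by (auto simp: orbit_def preserves_def)
    moreover have "orbit G p \<noteq> {}"
      using subgroup.one_closed[OF G] by (auto simp: orbit_def)
    ultimately show False
      using no_surface_in_projective_line[OF p(2) _ _ P(1,2)] \<phi> by blast
  qed
  \<comment> \<open>The cone over the given orbit, thickened by \<open>e\<close>, would contain an open set and be negligible.\<close>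
  have no_open_orbit: False if "X1 \<in> tangent" "X2 \<in> tangent" "X3 \<in> tangent"
    "\<forall>w. \<exists>t1 t2 t3 t4 r. w = t1 *\<^sub>R (X1 *v y) + t2 *\<^sub>R (X2 *v y) + t3 *\<^sub>R (X3 *v y) + t4 *\<^sub>R y + r *\<^sub>R e"
    for X1 X2 X3 e
  proof -
    have "{A *v y + r *\<^sub>R e | A r. A \<in> lifts G} \<subseteq> {z + r *\<^sub>R e | z r. z \<in> lifts (orbit G p)}"
      using orbit by blast
    then have "negligible {A *v y + r *\<^sub>R e | A r. A \<in> lifts G}"
      by (rule negligible_subset[OF negligible_cone_over_surface[OF p(2)]])
    moreover have "\<not> negligible {A *v y + r *\<^sub>R e | A r. A \<in> lifts G}"
      by (rule orbit_not_negligible[OF linear_group_axioms that(1-3)]) (use that(4) in blast)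
    ultimately show False
      by blast
  qed
  have similarity: "\<exists>\<kappa>. \<forall>u v. bil (A *v u) (A *v v) = \<kappa> * bil u v" if "A \<in> lifts G" for A
    by (rule lift_similarity[OF G_sub that]) blast
  have "(\<exists>v. v \<noteq> 0 \<and> (\<forall>X\<in>tangent. X *v v \<in> span {v})) \<or>
    (\<forall>p. qf p = 0 \<longrightarrow> p \<notin> span {e1, e2} \<longrightarrow>
      (\<exists>X1\<in>tangent. \<exists>X2\<in>tangent. \<exists>X3\<in>tangent. \<exists>e. \<forall>w.
        \<exists>t1 t2 t3 t4 r. w = t1 *\<^sub>R (X1 *v p) + t2 *\<^sub>R (X2 *v p) + t3 *\<^sub>R (X3 *v p) + t4 *\<^sub>R p + r *\<^sub>R e))"
  proof (rule invariant_line_or_open_orbits[OF subspace_tangent one_in_tangent tangent_bracket])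
    show "\<exists>k. \<forall>u v. bil (X *v u) v + bil u (X *v v) = 2 * k * bil u v" if "X \<in> tangent" for X
      by (rule tangent_similarity[OF similarity linear_group_axioms that bil_basis(10)])
    show "X *v v \<in> span {e1, e2}" if "X \<in> tangent" "v \<in> span {e1, e2}" for X v
      by (rule tangent_apply_subspace[OF that(1) subspace_span stable[unfolded span_P, OF _ that(2)]])
  qed
  then have "\<exists>v. v \<noteq> 0 \<and> (\<forall>X\<in>tangent. X *v v \<in> span {v})"
  proof
    assume open_orbits: "\<forall>p. qf p = 0 \<longrightarrow> p \<notin> span {e1, e2} \<longrightarrow>
      (\<exists>X1\<in>tangent. \<exists>X2\<in>tangent. \<exists>X3\<in>tangent. \<exists>e. \<forall>w.
        \<exists>t1 t2 t3 t4 r. w = t1 *\<^sub>R (X1 *v p) + t2 *\<^sub>R (X2 *v p) + t3 *\<^sub>R (X3 *v p) + t4 *\<^sub>R p + r *\<^sub>R e)"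
    have "y \<notin> span {e1, e2}"
      using \<open>y \<notin> P\<close> span_P by simp
    from open_orbits[rule_format, OF y(1) this] show ?thesis
      by (elim bexE exE) (drule (3) no_open_orbit, erule FalseE)
  qed
  then obtain v where v: "v \<noteq> 0" "\<And>X. X \<in> tangent \<Longrightarrow> X *v v \<in> span {v}"
    by blast
  have fixed: "span {A *v v} = span {v}" if "A \<in> lifts G" for A
    using that by (intro invariant_line[OF linear_group_axioms T(2,3) _ v]) (simp_all add: T(1))
  have "span {v} \<in> RP4"
    using v(1) by (auto simp: RP4_def proj_def)
  moreover have "act g (span {v}) = span {v}" if "g \<in> G" for g
    using lift[OF that] fixed by (auto simp: act_span)
  moreover have "preserves G (Ein - proj (perp v))"
    using G v(1) fixed by (rule preserves_complement_of_fixed_perp)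
  moreover have "minkowski_patch (Ein - proj (perp v)) \<or> de_sitter_component (Ein - proj (perp v)) \<or>
      anti_de_sitter_component (Ein - proj (perp v))"
    unfolding minkowski_patch_def de_sitter_component_def anti_de_sitter_component_def
    using v(1) by (cases "qf v" "0 :: real" rule: linorder_cases) blast+
  ultimately show ?thesis
    by blast
qed

end
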